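(* Let Assumptions 1, 2, 3 and 4 (recalled in the context) hold, let $\lambda\in\mathcal{E}$ be a solution of the dual problem (D), and let $q\in\mathbb{N}\cup\{+\infty\}$ be the dimension of $\mathcal{E}$. Let $$J_{\mathrm{dec}}=\inf\{J(x)\mid x\in\mathcal{X},\ x_i\in\mathcal{X}_i(\lambda)\ \forall i=1,\dots,N\},\qquad p=J_{\mathrm{dec}}-J^*.$$ Then $$p\ \le\ J_{\mathrm{dec}}-\mathcal{J}^*\ \le\ \frac{1}{2N^2}\left(\max_{Q\subseteq\{1,\dots,N\},\ |Q|=q\wedge N}\ \sum_{i\in Q}\rho\big(\mathcal{Y}_i(\lambda)\big)^2\right),$$ where $q\wedge N=\min(q,N)$.
   Context: Setting. $N,M\ge1$ are integers; $\mathcal{X}_1,\dots,\mathcal{X}_N$ are nonempty sets and $\mathcal{X}=\prod_{i=1}^N\mathcal{X}_i$; $\mathcal{E}_1,\dots,\mathcal{E}_M$ are separable real Hilbert spaces and $\mathcal{E}=\prod_{j=1}^M\mathcal{E}_j$ with scalar product $\langle y,y'\rangle=\sum_j\langle y_j,y_j'\rangle_{\mathcal{E}_j}$. For each $i,j$ we are given maps $g_{ij}:\mathcal{X}_i\to\mathcal{E}_j$ and $f_j:\mathcal{E}_j\to\mathbb{R}$; $g_i=(g_{ij})_{j=1,\dots,M}$, $f(y)=\sum_{j=1}^M f_j(y_j)$, $G(x)=\frac1N\sum_{i=1}^Ng_i(x_i)$, $J(x)=f(G(x))$ and $J^*=\inf_{x\in\mathcal{X}}J(x)$. Randomized problem.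 For a set $\Omega$, $\mathcal{P}_\delta(\Omega)$ is the set of finitely supported probability measures $\sum_{k=1}^K\lambda_k\delta_{x_k}$ on $\Omega$. For such $\mu$ and a Hilbert-space-valued $F$ on $\Omega$, $E_\mu[F]=\sum_k\lambda_kF(x_k)$ and $\sigma_\mu^2[F]=\sum_k\lambda_k\|F(x_k)-E_\mu[F]\|^2$. Put $\mathcal{P}_\delta=\prod_{i=1}^N\mathcal{P}_\delta(\mathcal{X}_i)$, $\mathcal{J}(\mu)=f\big(\frac1N\sum_{i=1}^NE_{\mu_i}[g_i]\big)$, $\mathcal{J}^*=\inf_{\mu\in\mathcal{P}_\delta}\mathcal{J}(\mu)$. Assumption 1. Let $S_{ij}=g_{ij}(\mathcal{X}_i)$ and $S_j=\frac1N\sum_{i=1}^NS_{ij}$ (Minkowski sum). For all $i,j$: (1) $S_{ij}$ has finite diameter $d_{ij}$; (2) $f_j$ is $L_j$-Lipschitz on $\mathrm{conv}(S_j)$; (3) $f_j$ is continuously differentiable on a neighborhood of $\mathrm{conv}(S_j)$ and $\nabla f_j$ is $\tilde L_j$-Lipschitz on $\mathrm{conv}(S_j)$, where $\tilde L_j>0$. Assumption 2. For all $j$, $f_j$ is convex over $\mathrm{conv}(S_j)$. Assumption 3. Let $\mathcal{A}=\{\nabla f(y)\mid y\in\mathrm{conv}(G(\mathcal{X}))\}$. For all $i$ and all $\lambda\in\mathcal{A}$, the problem $\inf_{x_i\in\mathcal{X}_i}\langle\lambda,g_i(x_i)\rangle$ has at least one solution. Rescaling. $\tilde g_{ij}=\sqrt{\tilde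 L_j}\,g_{ij}$, $\tilde g_i=(\tilde g_{ij})_{j}$, $\tilde f_j(y_j)=f_j\big(y_j/\sqrt{\tilde L_j}\big)$, $\tilde f(y)=\sum_{j=1}^M\tilde f_j(y_j)$, $\mathcal{Y}_i=\tilde g_i(\mathcal{X}_i)$, $\mathcal{Y}=\frac1N\sum_{i=1}^N\mathcal{Y}_i$ (Minkowski sum). Assumption 4. $f:\mathcal{E}\to\mathbb{R}$ is lower semi-continuous and convex, and $\mathrm{conv}(\mathcal{Y})$ is closed. Dual problem. For $\lambda\in\mathcal{E}$: $\Phi_i(\lambda)=\inf_{x_i\in\mathcal{X}_i}\langle\lambda,\tilde g_i(x_i)\rangle$, $\mathcal{Y}_i(\lambda)=\mathrm{argmin}_{y_i\in\mathcal{Y}_i}\langle\lambda,y_i\rangle$, $\mathcal{X}_i(\lambda)=\mathrm{argmin}_{x_i\in\mathcal{X}_i}\langle\lambda,\tilde g_i(x_i)\rangle$ (sets of minimizers). The dual problem is (D): $\sup_{\lambda\in\mathcal{E}}\big(-\tilde f^*(\lambda)+\frac1N\sum_{i=1}^N\Phi_i(\lambda)\big)$, with $\tilde f^*(\lambda)=\sup_{y\in\mathcal{E}}\langle\lambda,y\rangle-\tilde f(y)$ the Fenchel conjugate. Nonconvexity measure. For $\mathcal{K}\subseteq\mathcal{E}$, $\rho(\mathcal{K})=\big(\sup_{y\in\mathrm{conv}(\mathcal{K})}\inf_{\mu\in\mathcal{P}_\delta(\mathcal{K}),\,E_\mu[\mathrm{Id}]=y}\sigma^2_\mu[\mathrm{Id}]\big)^{1/2}$,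 where $\mathrm{Id}$ is the identity map. *)

theory Defs
  imports "HOL-Probability.Probability" "HOL-Library.Set_Algebras" "HOL-Library.Extended_Nat"
begin

text \<open>
  Index sets \<open>{1..N}\<close> and \<open>{1..M}\<close> are the finite types \<open>'n\<close> and \<open>'m\<close>.  The Hilbert spaces
  \<open>\<E>\<^sub>j\<close> may differ from one \<open>j\<close> to the next, so they are closed linear subspaces \<open>E j\<close> of a common
  complete inner product space \<open>'e\<close>, which is itself not assumed separable (any finite family of
  Hilbert spaces embeds isometrically in its direct sum).  Likewise the sets \<open>X i\<close> live in a
  common type \<open>'x\<close>.  The functions \<open>f j\<close> and \<open>g i j\<close> are total, but only their values on
  \<open>E j\<close> and \<open>X i\<close> are ever used.
  All infima and suprema are taken in the extended reals.
\<close>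

definition separable_hilbert_subspace :: "'e::{real_inner,complete_space} set \<Rightarrow> bool" where
  "separable_hilbert_subspace H \<longleftrightarrow> subspace H \<and> closed H \<and> separable_space (top_of_set H)"

text \<open>The library inner product on \<open>'e ^ 'm\<close> is the sum of the componentwise inner products.\<close>

definition prod_space :: "('m::finite \<Rightarrow> 'e::{real_inner,complete_space} set) \<Rightarrow> ('e ^ 'm) set" where
  "prod_space E = {y. \<forall>j. y $ j \<in> E j}"

text \<open>\<open>real_vector.dim\<close> is a natural number and has a junk value in infinite dimension.\<close>

definition edim :: "'a::real_vector set \<Rightarrow> enat" where
  "edim V = (if \<exists>B. finite B \<and> V \<subseteq> span B then enat (dim V) else \<infinity>)"

text \<open>Gradients are relative to the Hilbert space \<open>H\<close>: for \<open>H \<noteq> UNIV\<close>, membership in \<open>H\<close> is what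
  makes the Riesz representative unique.\<close>

definition has_gradient :: "'a::real_inner set \<Rightarrow> ('a \<Rightarrow> real) \<Rightarrow> 'a \<Rightarrow> 'a \<Rightarrow> bool" where
  "has_gradient H f y v \<longleftrightarrow> v \<in> H \<and> (f has_derivative (\<lambda>h. h \<bullet> v)) (at y within H)"

definition gradient :: "'a::real_inner set \<Rightarrow> ('a \<Rightarrow> real) \<Rightarrow> 'a \<Rightarrow> 'a" where
  "gradient H f y = (THE v. has_gradient H f y v)"

definition continuously_differentiable_near ::
  "'a::real_inner set \<Rightarrow> ('a \<Rightarrow> real) \<Rightarrow> 'a set \<Rightarrow> bool" where
  "continuously_differentiable_near H f C \<longleftrightarrow>
     (\<exists>U. openin (top_of_set H) U \<and> C \<subseteq> U \<and>
          (\<forall>y\<in>U. \<exists>v. has_gradient H f y v) \<and> continuous_on U (gradient H f))"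

definition lsc_on :: "'a::topological_space set \<Rightarrow> ('a \<Rightarrow> real) \<Rightarrow> bool" where
  "lsc_on H f \<longleftrightarrow> (\<forall>y\<in>H. \<forall>a<f y. \<forall>\<^sub>F z in at y within H. a < f z)"

definition argmin_set :: "('a \<Rightarrow> real) \<Rightarrow> 'a set \<Rightarrow> 'a set" where
  "argmin_set F A = {a. is_arg_min F (\<lambda>x. x \<in> A) a}"

definition avg :: "('n::finite \<Rightarrow> 'a::real_vector) \<Rightarrow> 'a" where
  "avg y = (1 / real CARD('n)) *\<^sub>R (\<Sum>i\<in>UNIV. y i)"

text \<open>The sum is the Minkowski sum of \<^theory>\<open>HOL-Library.Set_Algebras\<close>.\<close>

definition set_avg :: "('n::finite \<Rightarrow> 'a::real_vector set) \<Rightarrow> 'a set" where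
  "set_avg A = (\<lambda>y. (1 / real CARD('n)) *\<^sub>R y) ` (\<Sum>i\<in>UNIV. A i)"


definition gvec :: "('n \<Rightarrow> 'm \<Rightarrow> 'x \<Rightarrow> 'e) \<Rightarrow> 'n \<Rightarrow> 'x \<Rightarrow> 'e ^ 'm::finite" where
  "gvec g i x = (\<chi> j. g i j x)"

definition fsum :: "('m \<Rightarrow> 'e \<Rightarrow> real) \<Rightarrow> 'e ^ 'm::finite \<Rightarrow> real" where
  "fsum f y = (\<Sum>j\<in>UNIV. f j (y $ j))"

definition Gmap :: "('n::finite \<Rightarrow> 'm \<Rightarrow> 'x \<Rightarrow> 'e::real_vector) \<Rightarrow> ('n \<Rightarrow> 'x) \<Rightarrow> 'e ^ 'm::finite" where
  "Gmap g x = avg (\<lambda>i. gvec g i (x i))"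

definition cost ::
  "('m \<Rightarrow> 'e \<Rightarrow> real) \<Rightarrow> ('n::finite \<Rightarrow> 'm::finite \<Rightarrow> 'x \<Rightarrow> 'e::real_vector) \<Rightarrow> ('n \<Rightarrow> 'x) \<Rightarrow> real" where
  "cost f g x = fsum f (Gmap g x)"

definition opt_val ::
  "('n::finite \<Rightarrow> 'x set) \<Rightarrow> ('m \<Rightarrow> 'e \<Rightarrow> real) \<Rightarrow> ('n \<Rightarrow> 'm::finite \<Rightarrow> 'x \<Rightarrow> 'e::real_vector) \<Rightarrow> ereal" where
  "opt_val X f g = (INF x\<in>Pi UNIV X. ereal (cost f g x))"


definition fin_prob :: "'a set \<Rightarrow> 'a pmf set" where
  "fin_prob A = {\<mu>. finite (set_pmf \<mu>) \<and> set_pmf \<mu> \<subseteq> A}"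

definition mean :: "'a pmf \<Rightarrow> ('a \<Rightarrow> 'b::real_vector) \<Rightarrow> 'b" where
  "mean \<mu> F = (\<Sum>x\<in>set_pmf \<mu>. pmf \<mu> x *\<^sub>R F x)"

definition var :: "'a pmf \<Rightarrow> ('a \<Rightarrow> 'b::real_normed_vector) \<Rightarrow> real" where
  "var \<mu> F = (\<Sum>x\<in>set_pmf \<mu>. pmf \<mu> x * (norm (F x - mean \<mu> F))\<^sup>2)"

definition rand_cost ::
  "('m \<Rightarrow> 'e \<Rightarrow> real) \<Rightarrow> ('n::finite \<Rightarrow> 'm::finite \<Rightarrow> 'x \<Rightarrow> 'e::real_vector) \<Rightarrow> ('n \<Rightarrow> 'x pmf) \<Rightarrow> real" where
  "rand_cost f g \<mu> = fsum f (avg (\<lambda>i. mean (\<mu> i) (gvec g i)))"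

definition rand_opt_val ::
  "('n::finite \<Rightarrow> 'x set) \<Rightarrow> ('m \<Rightarrow> 'e \<Rightarrow> real) \<Rightarrow> ('n \<Rightarrow> 'm::finite \<Rightarrow> 'x \<Rightarrow> 'e::real_vector) \<Rightarrow> ereal" where
  "rand_opt_val X f g = (INF \<mu>\<in>(\<Pi> i\<in>UNIV. fin_prob (X i)). ereal (rand_cost f g \<mu>))"

text \<open>The value \<open>-\<infinity>\<close> arises only as the supremum over the empty set, where \<open>ereal_sqrt\<close> gives 0.\<close>

definition ereal_sqrt :: "ereal \<Rightarrow> ereal" where
  "ereal_sqrt v = (if v = \<infinity> then \<infinity> else ereal (sqrt (real_of_ereal v)))"

definition rho :: "'a::real_inner set \<Rightarrow> ereal" where
  "rho K = ereal_sqrt (SUP y\<in>convex hull K. INF \<mu>\<in>{\<mu> \<in> fin_prob K. mean \<mu> id = y}. ereal (var \<mu> id))"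


definition S_set ::
  "('n::finite \<Rightarrow> 'x set) \<Rightarrow> ('n \<Rightarrow> 'm \<Rightarrow> 'x \<Rightarrow> 'e::real_vector) \<Rightarrow> 'm \<Rightarrow> 'e set" where
  "S_set X g j = set_avg (\<lambda>i. g i j ` X i)"

definition assumption1 ::
  "('n::finite \<Rightarrow> 'x set) \<Rightarrow> ('m::finite \<Rightarrow> 'e::{real_inner,complete_space} set) \<Rightarrow>
   ('n \<Rightarrow> 'm \<Rightarrow> 'x \<Rightarrow> 'e) \<Rightarrow> ('m \<Rightarrow> 'e \<Rightarrow> real) \<Rightarrow> ('m \<Rightarrow> real) \<Rightarrow> ('m \<Rightarrow> real) \<Rightarrow> bool" where
  "assumption1 X E g f L Lt \<longleftrightarrow>
     (\<forall>i j. bounded (g i j ` X i)) \<and>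
     (\<forall>j. (L j)-lipschitz_on (convex hull S_set X g j) (f j)) \<and>
     (\<forall>j. continuously_differentiable_near (E j) (f j) (convex hull S_set X g j) \<and>
          (Lt j)-lipschitz_on (convex hull S_set X g j) (gradient (E j) (f j)) \<and> Lt j > 0)"

definition assumption2 ::
  "('n::finite \<Rightarrow> 'x set) \<Rightarrow> ('n \<Rightarrow> 'm::finite \<Rightarrow> 'x \<Rightarrow> 'e::{real_inner,complete_space}) \<Rightarrow>
   ('m \<Rightarrow> 'e \<Rightarrow> real) \<Rightarrow> bool" where
  "assumption2 X g f \<longleftrightarrow> (\<forall>j. convex_on (convex hull S_set X g j) (f j))"

definition assumption3 ::
  "('n::finite \<Rightarrow> 'x set) \<Rightarrow> ('m::finite \<Rightarrow> 'e::{real_inner,complete_space} set) \<Rightarrow>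
   ('n \<Rightarrow> 'm \<Rightarrow> 'x \<Rightarrow> 'e) \<Rightarrow> ('m \<Rightarrow> 'e \<Rightarrow> real) \<Rightarrow> bool" where
  "assumption3 X E g f \<longleftrightarrow>
     (\<forall>i. \<forall>l \<in> gradient (prod_space E) (fsum f) ` (convex hull (Gmap g ` Pi UNIV X)).
        argmin_set (\<lambda>x. l \<bullet> gvec g i x) (X i) \<noteq> {})"


definition resc_g :: "('m \<Rightarrow> real) \<Rightarrow> ('n \<Rightarrow> 'm \<Rightarrow> 'x \<Rightarrow> 'e::real_vector) \<Rightarrow> 'n \<Rightarrow> 'm \<Rightarrow> 'x \<Rightarrow> 'e" where
  "resc_g Lt g i j x = sqrt (Lt j) *\<^sub>R g i j x"

definition resc_f :: "('m \<Rightarrow> real) \<Rightarrow> ('m \<Rightarrow> 'e::real_vector \<Rightarrow> real) \<Rightarrow> 'm \<Rightarrow> 'e \<Rightarrow> real" where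
  "resc_f Lt f j y = f j (y /\<^sub>R sqrt (Lt j))"

definition Y_set ::
  "('n \<Rightarrow> 'x set) \<Rightarrow> ('n \<Rightarrow> 'm::finite \<Rightarrow> 'x \<Rightarrow> 'e::real_vector) \<Rightarrow> ('m \<Rightarrow> real) \<Rightarrow> 'n \<Rightarrow> ('e ^ 'm) set" where
  "Y_set X g Lt i = gvec (resc_g Lt g) i ` X i"

definition assumption4 ::
  "('n::finite \<Rightarrow> 'x set) \<Rightarrow> ('m::finite \<Rightarrow> 'e::{real_inner,complete_space} set) \<Rightarrow>
   ('n \<Rightarrow> 'm \<Rightarrow> 'x \<Rightarrow> 'e) \<Rightarrow> ('m \<Rightarrow> 'e \<Rightarrow> real) \<Rightarrow> ('m \<Rightarrow> real) \<Rightarrow> bool" where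
  "assumption4 X E g f Lt \<longleftrightarrow>
     lsc_on (prod_space E) (fsum f) \<and> convex_on (prod_space E) (fsum f) \<and>
     closed (convex hull (set_avg (Y_set X g Lt)))"


definition fenchel_conj :: "'a::real_inner set \<Rightarrow> ('a \<Rightarrow> real) \<Rightarrow> 'a \<Rightarrow> ereal" where
  "fenchel_conj H F l = (SUP y\<in>H. ereal (l \<bullet> y - F y))"

definition Phi ::
  "('n \<Rightarrow> 'x set) \<Rightarrow> ('n \<Rightarrow> 'm::finite \<Rightarrow> 'x \<Rightarrow> 'e::real_inner) \<Rightarrow> ('m \<Rightarrow> real) \<Rightarrow> 'n \<Rightarrow> 'e ^ 'm \<Rightarrow> ereal" where
  "Phi X g Lt i l = (INF x\<in>X i. ereal (l \<bullet> gvec (resc_g Lt g) i x))"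

definition Y_argmin ::
  "('n \<Rightarrow> 'x set) \<Rightarrow> ('n \<Rightarrow> 'm::finite \<Rightarrow> 'x \<Rightarrow> 'e::real_inner) \<Rightarrow> ('m \<Rightarrow> real) \<Rightarrow> 'n \<Rightarrow> 'e ^ 'm \<Rightarrow> ('e ^ 'm) set" where
  "Y_argmin X g Lt i l = argmin_set (\<lambda>y. l \<bullet> y) (Y_set X g Lt i)"

definition X_argmin ::
  "('n \<Rightarrow> 'x set) \<Rightarrow> ('n \<Rightarrow> 'm::finite \<Rightarrow> 'x \<Rightarrow> 'e::real_inner) \<Rightarrow> ('m \<Rightarrow> real) \<Rightarrow> 'n \<Rightarrow> 'e ^ 'm \<Rightarrow> 'x set" where
  "X_argmin X g Lt i l = argmin_set (\<lambda>x. l \<bullet> gvec (resc_g Lt g) i x) (X i)"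

definition dual_obj ::
  "('n::finite \<Rightarrow> 'x set) \<Rightarrow> ('m::finite \<Rightarrow> 'e::{real_inner,complete_space} set) \<Rightarrow>
   ('n \<Rightarrow> 'm \<Rightarrow> 'x \<Rightarrow> 'e) \<Rightarrow> ('m \<Rightarrow> 'e \<Rightarrow> real) \<Rightarrow> ('m \<Rightarrow> real) \<Rightarrow> 'e ^ 'm \<Rightarrow> ereal" where
  "dual_obj X E g f Lt l =
     - fenchel_conj (prod_space E) (fsum (resc_f Lt f)) l
     + ereal (1 / real CARD('n)) * (\<Sum>i\<in>UNIV. Phi X g Lt i l)"

definition dual_solution ::
  "('n::finite \<Rightarrow> 'x set) \<Rightarrow> ('m::finite \<Rightarrow> 'e::{real_inner,complete_space} set) \<Rightarrow>
   ('n \<Rightarrow> 'm \<Rightarrow> 'x \<Rightarrow> 'e) \<Rightarrow> ('m \<Rightarrow> 'e \<Rightarrow> real) \<Rightarrow> ('m \<Rightarrow> real) \<Rightarrow> 'e ^ 'm \<Rightarrow> bool" where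
  "dual_solution X E g f Lt l \<longleftrightarrow>
     l \<in> prod_space E \<and> dual_obj X E g f Lt l = (SUP l'\<in>prod_space E. dual_obj X E g f Lt l')"

definition J_dec ::
  "('n::finite \<Rightarrow> 'x set) \<Rightarrow> ('n \<Rightarrow> 'm::finite \<Rightarrow> 'x \<Rightarrow> 'e::real_inner) \<Rightarrow> ('m \<Rightarrow> 'e \<Rightarrow> real) \<Rightarrow>
   ('m \<Rightarrow> real) \<Rightarrow> 'e ^ 'm \<Rightarrow> ereal" where
  "J_dec X g f Lt l =
     (INF x\<in>{x \<in> Pi UNIV X. \<forall>i. x i \<in> X_argmin X g Lt i l}. ereal (cost f g x))"

end

theory Submission
  imports Defs
begin

text \<open>
  Write \<open>C\<close> for \<open>conv(\<Y>)\<close> and \<open>F\<close> for the rescaled cost.  By completeness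
  \<open>F\<close> attains its minimum over \<open>C\<close> at some \<open>y\<close>, and \<open>\<nabla>F(y)\<close> is a dual point of value \<open>F(y)\<close>; hence every dual
  solution \<open>\<lambda>\<close> has at least this value, and complementarity places \<open>y\<close> in the average of the convex hulls
  of the \<open>\<Y>\<^sub>i(\<lambda>)\<close>.  Shapley--Folkman lets all but \<open>q \<and> N\<close> summands lie in \<open>\<Y>\<^sub>i(\<lambda>)\<close> itself, and the others are
  rounded: since \<open>\<nabla>F\<close> is 1-Lipschitz on \<open>C\<close>, independent random choices of mean \<open>y\<^sub>i\<close> raise \<open>F\<close> on average
  by at most the sum of the variances divided by \<open>2 N\<^sup>2\<close>.
\<close>

section \<open>Finitely supported distributions\<close>

lemma mean_superset:
  assumes "finite S" "set_pmf \<mu> \<subseteq> S"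
  shows "mean \<mu> F = (\<Sum>x\<in>S. pmf \<mu> x *\<^sub>R F x)"
  unfolding mean_def using assms by (intro sum.mono_neutral_left) (auto simp: set_pmf_iff)

lemma sum_pmf_set_pmf: "finite (set_pmf \<mu>) \<Longrightarrow> (\<Sum>x\<in>set_pmf \<mu>. pmf \<mu> x) = 1"
  by (rule sum_pmf_eq_1) auto

lemma mean_return_pmf [simp]: "mean (return_pmf a) F = F a"
  by (simp add: mean_def)

lemma pmf_of_weights:
  fixes w :: "'a \<Rightarrow> real"
  assumes "finite S" "\<And>x. x \<in> S \<Longrightarrow> 0 \<le> w x" "sum w S = 1"
  obtains \<mu> where "\<And>x. pmf \<mu> x = (if x \<in> S then w x else 0)"
proof
  define h where "h = (\<lambda>x. if x \<in> S then w x else 0)"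
  have nn: "0 \<le> h x" for x using assms(2) by (simp add: h_def)
  have "(\<integral>\<^sup>+ x. ennreal (h x) \<partial>count_space UNIV) = (\<Sum>x\<in>S. ennreal (h x))"
    using assms(1) by (intro nn_integral_count_space'[OF assms(1)]) (auto simp: h_def)
  also have "\<dots> = ennreal (sum h S)" using nn by (simp add: sum_ennreal)
  also have "sum h S = 1" using assms(3) by (simp add: h_def)
  finally have "(\<integral>\<^sup>+ x. ennreal (h x) \<partial>count_space UNIV) = 1" by simp
  then show "pmf (embed_pmf h) x = (if x \<in> S then w x else 0)" for x
    using pmf_embed_pmf[of h] nn by (simp add: h_def)
qed

lemma convex_hull_pmf:
  assumes "y \<in> convex hull K"
  obtains \<mu> where "\<mu> \<in> fin_prob K" "mean \<mu> id = y"
proof -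
  obtain S u where S: "finite S" "S \<subseteq> K" "\<forall>x\<in>S. 0 \<le> u x" "sum u S = 1" "(\<Sum>v\<in>S. u v *\<^sub>R v) = y"
    using assms unfolding convex_hull_explicit by blast
  obtain \<mu> where \<mu>: "\<And>x. pmf \<mu> x = (if x \<in> S then u x else 0)"
    using pmf_of_weights[of S u] S by blast
  have sub: "set_pmf \<mu> \<subseteq> S" by (auto simp: set_pmf_iff \<mu> split: if_splits)
  have "mean \<mu> id = y" using mean_superset[OF S(1) sub, of id] S(5) by (simp add: \<mu>)
  moreover have "\<mu> \<in> fin_prob K" using sub S(1,2) by (auto simp: fin_prob_def intro: finite_subset)
  ultimately show ?thesis using that by blast
qed

lemma mean_in_convex_hull:
  assumes "\<mu> \<in> fin_prob A"
  shows "mean \<mu> F \<in> convex hull (F ` A)"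
  unfolding mean_def
  using assms by (intro convex_sum) (auto simp: fin_prob_def sum_pmf_set_pmf intro!: hull_inc)

text \<open>Stands in for the probabilistic method: an expectation bound becomes a concrete point of
  the support.\<close>

lemma pmf_le_mean:
  fixes h :: "'a \<Rightarrow> real"
  assumes "finite (set_pmf \<mu>)"
  obtains z where "z \<in> set_pmf \<mu>" "h z \<le> (\<Sum>x\<in>set_pmf \<mu>. pmf \<mu> x * h x)"
proof (rule ccontr)
  assume "\<not> thesis"
  then have *: "\<And>z. z \<in> set_pmf \<mu> \<Longrightarrow> (\<Sum>x\<in>set_pmf \<mu>. pmf \<mu> x * h x) < h z"
    using that by force
  define m where "m = (\<Sum>x\<in>set_pmf \<mu>. pmf \<mu> x * h x)"
  have "(\<Sum>x\<in>set_pmf \<mu>. pmf \<mu> x * m) < (\<Sum>x\<in>set_pmf \<mu>. pmf \<mu> x * h x)"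
    using * assms by (intro sum_strict_mono) (auto simp: m_def set_pmf_not_empty pmf_positive)
  moreover have "(\<Sum>x\<in>set_pmf \<mu>. pmf \<mu> x * m) = m"
    using sum_pmf_set_pmf[OF assms] by (simp add: sum_distrib_right[symmetric])
  ultimately show False by (simp add: m_def)
qed

lemma var_nonneg: "0 \<le> var \<mu> F"
  unfolding var_def by (intro sum_nonneg) auto

lemma inner_mean: "l \<bullet> mean \<mu> F = (\<Sum>x\<in>set_pmf \<mu>. pmf \<mu> x * (l \<bullet> F x))"
  by (simp add: mean_def inner_sum_right)

text \<open>Under \<open>\<mu>\<close> the linear term averages to zero and the quadratic term to
  the variance, so some support point does no worse than the average.\<close>

lemma pmf_le_inner_var:
  fixes u :: "'a::real_inner"
  assumes "finite (set_pmf \<mu>)"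
  obtains z where "z \<in> set_pmf \<mu>"
    "u \<bullet> (z - mean \<mu> id) + (norm (z - mean \<mu> id))\<^sup>2 \<le> var \<mu> id"
proof -
  define h where "h = (\<lambda>z. u \<bullet> (z - mean \<mu> id) + (norm (z - mean \<mu> id))\<^sup>2)"
  have "(\<Sum>x\<in>set_pmf \<mu>. pmf \<mu> x * (u \<bullet> (x - mean \<mu> id))) =
    u \<bullet> mean \<mu> id - (\<Sum>x\<in>set_pmf \<mu>. pmf \<mu> x) * (u \<bullet> mean \<mu> id)"
    by (subst inner_mean) (simp add: inner_diff_right right_diff_distrib sum_subtractf sum_distrib_right)
  then have "(\<Sum>x\<in>set_pmf \<mu>. pmf \<mu> x * h x) = var \<mu> id"
    using sum_pmf_set_pmf[OF assms] by (simp add: h_def var_def distrib_left sum.distrib)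
  then show ?thesis using pmf_le_mean[OF assms, of h] that unfolding h_def by metis
qed

text \<open>Choosing the points one index at a time replaces the expectation over the product measure.\<close>

lemma select_points:
  fixes u :: "'a::real_inner" and \<mu> :: "'i \<Rightarrow> 'a pmf"
  assumes "finite I" "\<And>i. i \<in> I \<Longrightarrow> finite (set_pmf (\<mu> i))"
  shows "\<exists>z. (\<forall>i\<in>I. z i \<in> set_pmf (\<mu> i)) \<and>
    u \<bullet> (\<Sum>i\<in>I. z i - mean (\<mu> i) id) + (norm (\<Sum>i\<in>I. z i - mean (\<mu> i) id))\<^sup>2
      \<le> (\<Sum>i\<in>I. var (\<mu> i) id)"
  using assms
proof (induction I rule: finite_induct)
  case empty
  then show ?case by simp
next
  case (insert k I)
  then obtain z where z: "\<forall>i\<in>I. z i \<in> set_pmf (\<mu> i)"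
    and le: "u \<bullet> (\<Sum>i\<in>I. z i - mean (\<mu> i) id) + (norm (\<Sum>i\<in>I. z i - mean (\<mu> i) id))\<^sup>2
      \<le> (\<Sum>i\<in>I. var (\<mu> i) id)" by blast
  define D where "D = (\<Sum>i\<in>I. z i - mean (\<mu> i) id)"
  \<comment> \<open>Expanding the squared norm of \<open>D + (a - mean (\<mu> k) id)\<close> creates
    the cross term \<open>2 *\<^sub>R D \<bullet> (a - mean (\<mu> k) id)\<close>. Absorbing it into
    the linear functional reduces the step to a single index.\<close>
  obtain a where a: "a \<in> set_pmf (\<mu> k)"
    "(u + 2 *\<^sub>R D) \<bullet> (a - mean (\<mu> k) id) + (norm (a - mean (\<mu> k) id))\<^sup>2 \<le> var (\<mu> k) id"
    using pmf_le_inner_var[of "\<mu> k" "u + 2 *\<^sub>R D"] insert.prems by auto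
  have eq: "(\<Sum>i\<in>insert k I. (z(k := a)) i - mean (\<mu> i) id) = D + (a - mean (\<mu> k) id)"
    using insert.hyps by (auto simp: D_def add.commute intro!: sum.cong)
  have "u \<bullet> (D + (a - mean (\<mu> k) id)) + (norm (D + (a - mean (\<mu> k) id)))\<^sup>2
     = (u \<bullet> D + (norm D)\<^sup>2) +
       ((u + 2 *\<^sub>R D) \<bullet> (a - mean (\<mu> k) id) + (norm (a - mean (\<mu> k) id))\<^sup>2)"
    unfolding power2_norm_eq_inner by (simp add: inner_add_left inner_add_right inner_commute)
  also have "\<dots> \<le> (\<Sum>i\<in>insert k I. var (\<mu> i) id)"
    using le a(2) insert.hyps by (simp add: D_def)
  finally have "u \<bullet> (\<Sum>i\<in>insert k I. (z(k := a)) i - mean (\<mu> i) id) +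
      (norm (\<Sum>i\<in>insert k I. (z(k := a)) i - mean (\<mu> i) id))\<^sup>2 \<le> (\<Sum>i\<in>insert k I. var (\<mu> i) id)"
    unfolding eq .
  moreover have "\<forall>i\<in>insert k I. (z(k := a)) i \<in> set_pmf (\<mu> i)"
    using z a(1) by simp
  ultimately show ?case by blast
qed

text \<open>The exchange step for Shapley--Folkman: weight \<open>s\<close> travels from
  \<open>b\<close> to \<open>a\<close>, and taking the whole weight of \<open>b\<close> removes a
  support point.\<close>

lemma move_mass:
  fixes \<mu> :: "'a::real_vector pmf"
  assumes fin: "finite (set_pmf \<mu>)" and ab: "a \<in> set_pmf \<mu>" "b \<in> set_pmf \<mu>" "a \<noteq> b"
    and s: "0 \<le> s" "s \<le> pmf \<mu> b"
  obtains \<nu> where "set_pmf \<nu> \<subseteq> set_pmf \<mu>" "mean \<nu> id = mean \<mu> id + s *\<^sub>R (a - b)"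
    "s = pmf \<mu> b \<Longrightarrow> b \<notin> set_pmf \<nu>"
proof -
  let ?S = "set_pmf \<mu>"
  define w where "w = (\<lambda>x. pmf \<mu> x + (if x = a then s else 0) - (if x = b then s else 0))"
  have "sum w ?S = 1"
    using fin ab sum_pmf_set_pmf[OF fin] by (simp add: w_def sum.distrib sum_subtractf)
  moreover have "0 \<le> w x" for x using s ab by (auto simp: w_def)
  ultimately obtain \<nu> where \<nu>: "\<And>x. pmf \<nu> x = (if x \<in> ?S then w x else 0)"
    using pmf_of_weights[of ?S w] fin by blast
  have sub: "set_pmf \<nu> \<subseteq> ?S" by (auto simp: set_pmf_iff \<nu> split: if_splits)
  have "mean \<nu> id = (\<Sum>x\<in>?S. pmf \<mu> x *\<^sub>R x + (if x = a then s *\<^sub>R a else 0) - (if x = b then s *\<^sub>R b else 0))"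
    unfolding mean_superset[OF fin sub]
    by (intro sum.cong) (auto simp: \<nu> w_def scaleR_left_distrib scaleR_left_diff_distrib)
  also have "\<dots> = mean \<mu> id + s *\<^sub>R (a - b)"
    using fin ab by (simp add: sum.distrib sum_subtractf mean_def scaleR_right_diff_distrib)
  finally have "mean \<nu> id = mean \<mu> id + s *\<^sub>R (a - b)" .
  moreover have "b \<notin> set_pmf \<nu>" if "s = pmf \<mu> b" using that ab by (simp add: set_pmf_iff \<nu> w_def)
  ultimately show ?thesis using that sub by blast
qed

section \<open>The Shapley--Folkman theorem\<close>

text \<open>Indexed rather than set-based, because distinct indices may carry the same vector. A
  repeated vector gives the relation with coefficients 1 and -1; otherwise the usual dimension count
  applies.\<close>

lemma linear_dependence_family:
  fixes v :: "'i \<Rightarrow> 'a::real_vector"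
  assumes "finite I" "finite B" "v ` I \<subseteq> span B" "card B < card I"
  obtains c where "\<exists>i\<in>I. c i \<noteq> 0" "(\<Sum>i\<in>I. c i *\<^sub>R v i) = 0"
proof (cases "inj_on v I")
  case True
  then have "card B < card (v ` I)" using assms by (simp add: card_image)
  then have "dependent (v ` I)"
    using independent_span_bound[OF assms(2) _ assms(3)] by force
  then obtain u where "\<exists>x\<in>v ` I. u x \<noteq> 0" "(\<Sum>x\<in>v ` I. u x *\<^sub>R x) = 0"
    using dependent_finite[of "v ` I"] assms(1) by auto
  then show ?thesis
    using that[of "u \<circ> v"] by (auto simp: sum.reindex[OF True])
next
  case False
  then obtain i j where ij: "i \<in> I" "j \<in> I" "i \<noteq> j" "v i = v j" by (auto simp: inj_on_def)
  define c :: "'i \<Rightarrow> real" where c_def: "c = (\<lambda>k. (if k = i then 1 else 0) - (if k = j then 1 else 0))"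
  have ci: "c i \<noteq> 0" using ij by (simp add: c_def)
  have "(\<Sum>k\<in>I. c k *\<^sub>R v k) = (\<Sum>k\<in>I. (if k = i then v i else 0) - (if k = j then v j else 0))"
    using ij by (intro sum.cong) (auto simp: c_def)
  also have "\<dots> = 0" using ij assms(1) by (simp add: sum_subtractf)
  finally show ?thesis using that[of c] ci ij(1) by blast
qed

text \<open>Among families with the prescribed sum of means, take one of least total support size.
  If more than \<open>card B\<close> members had two support points, the differences of these points
  would be linearly dependent. Moving mass along such a relation preserves the sum and can be
  continued until a support point vanishes, contradicting minimality.\<close>

lemma shapley_folkman:
  fixes \<mu> :: "'n::finite \<Rightarrow> 'a::real_vector pmf"
  assumes \<mu>: "\<And>i. \<mu> i \<in> fin_prob (A i)" and AB: "\<And>i. A i \<subseteq> span B" and B: "finite B"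
  shows "\<exists>\<nu>. (\<forall>i. \<nu> i \<in> fin_prob (A i)) \<and> (\<Sum>i\<in>UNIV. mean (\<nu> i) id) = (\<Sum>i\<in>UNIV. mean (\<mu> i) id)
    \<and> card {i. \<forall>a. \<nu> i \<noteq> return_pmf a} \<le> card B"
proof -
  define P where "P = (\<lambda>\<nu>. (\<forall>i. \<nu> i \<in> fin_prob (A i)) \<and>
    (\<Sum>i\<in>UNIV. mean (\<nu> i) id) = (\<Sum>i\<in>UNIV. mean (\<mu> i) id))"
  define size where "size = (\<lambda>\<nu> :: 'n \<Rightarrow> 'a pmf. \<Sum>i\<in>UNIV. card (set_pmf (\<nu> i)))"
  have "P \<mu>" using \<mu> by (simp add: P_def)
  then obtain \<nu> where P: "P \<nu>" and least: "\<And>\<nu>'. P \<nu>' \<Longrightarrow> size \<nu> \<le> size \<nu>'"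
    using ex_has_least_nat[of P \<mu> size] by blast
  have fin: "finite (set_pmf (\<nu> i))" and sub: "set_pmf (\<nu> i) \<subseteq> A i" for i
    using P by (auto simp: P_def fin_prob_def)
  define I where "I = {i. \<forall>a. \<nu> i \<noteq> return_pmf a}"
  have "card I \<le> card B"
  proof (rule ccontr)
    assume "\<not> card I \<le> card B"
    have "\<exists>a b. a \<in> set_pmf (\<nu> i) \<and> b \<in> set_pmf (\<nu> i) \<and> a \<noteq> b" if "i \<in> I" for i
    proof -
      obtain a where a: "a \<in> set_pmf (\<nu> i)" using set_pmf_not_empty by fast
      have "\<not> set_pmf (\<nu> i) \<subseteq> {a}" using that by (simp add: I_def set_pmf_subset_singleton)
      then show ?thesis using a by blast
    qed
    then obtain a b where ab: "\<And>i. i \<in> I \<Longrightarrow> a i \<in> set_pmf (\<nu> i)" "\<And>i. i \<in> I \<Longrightarrow> b i \<in> set_pmf (\<nu> i)"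
      "\<And>i. i \<in> I \<Longrightarrow> a i \<noteq> b i" by metis
    have span: "(\<lambda>i. a i - b i) ` I \<subseteq> span B"
      using ab sub AB by (force intro!: span_diff)
    obtain c where c: "\<exists>i\<in>I. c i \<noteq> 0" "(\<Sum>i\<in>I. c i *\<^sub>R (a i - b i)) = 0"
      by (rule linear_dependence_family[OF _ B span]) (use \<open>\<not> card I \<le> card B\<close> in simp_all)
    \<comment> \<open>Swapping the two points where the coefficient is negative makes all
      coefficients nonnegative, so mass always moves from \<open>b'\<close> to
      \<open>a'\<close>.\<close>
    define a' where "a' = (\<lambda>i. if 0 \<le> c i then a i else b i)"
    define b' where "b' = (\<lambda>i. if 0 \<le> c i then b i else a i)"
    have ab': "a' i \<in> set_pmf (\<nu> i)" "b' i \<in> set_pmf (\<nu> i)" "a' i \<noteq> b' i" if "i \<in> I" for i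
      using ab[OF that] by (auto simp: a'_def b'_def)
    have c': "(\<Sum>i\<in>I. \<bar>c i\<bar> *\<^sub>R (a' i - b' i)) = 0"
      unfolding c(2)[symmetric] by (intro sum.cong) (auto simp: a'_def b'_def algebra_simps)
    define I' where "I' = {i \<in> I. c i \<noteq> 0}"
    \<comment> \<open>The largest step that keeps all weights nonnegative. At the minimizing index
      \<open>k\<close> the weight of \<open>b' k\<close> is used up exactly.\<close>
    define t where "t = Min ((\<lambda>i. pmf (\<nu> i) (b' i) / \<bar>c i\<bar>) ` I')"
    have I': "finite I'" "I' \<noteq> {}" using c(1) by (auto simp: I'_def)
    then have "t \<in> (\<lambda>i. pmf (\<nu> i) (b' i) / \<bar>c i\<bar>) ` I'" unfolding t_def by (intro Min_in) auto
    then obtain k where k: "k \<in> I'" "t = pmf (\<nu> k) (b' k) / \<bar>c k\<bar>" by auto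
    have t0: "0 \<le> t" using k by simp
    have tle: "t * \<bar>c i\<bar> \<le> pmf (\<nu> i) (b' i)" if "i \<in> I" for i
    proof (cases "c i = 0")
      case False
      then have "t \<le> pmf (\<nu> i) (b' i) / \<bar>c i\<bar>" using I' that by (auto simp: t_def I'_def intro!: Min_le)
      then show ?thesis using False by (simp add: field_simps)
    next
      case True
      then show ?thesis by simp
    qed
    have "\<exists>\<eta>. set_pmf \<eta> \<subseteq> set_pmf (\<nu> i) \<and> mean \<eta> id = mean (\<nu> i) id + (t * \<bar>c i\<bar>) *\<^sub>R (a' i - b' i)
      \<and> (t * \<bar>c i\<bar> = pmf (\<nu> i) (b' i) \<longrightarrow> b' i \<notin> set_pmf \<eta>)" if "i \<in> I" for i
      using move_mass[OF fin ab'(1)[OF that] ab'(2)[OF that] ab'(3)[OF that], of "t * \<bar>c i\<bar>"] t0 tle[OF that]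
      by (metis abs_ge_zero mult_nonneg_nonneg)
    then obtain \<eta> where \<eta>: "\<And>i. i \<in> I \<Longrightarrow> set_pmf (\<eta> i) \<subseteq> set_pmf (\<nu> i)"
      "\<And>i. i \<in> I \<Longrightarrow> mean (\<eta> i) id = mean (\<nu> i) id + (t * \<bar>c i\<bar>) *\<^sub>R (a' i - b' i)"
      "\<And>i. i \<in> I \<Longrightarrow> t * \<bar>c i\<bar> = pmf (\<nu> i) (b' i) \<Longrightarrow> b' i \<notin> set_pmf (\<eta> i)"
      by metis
    define \<nu>' where "\<nu>' = (\<lambda>i. if i \<in> I then \<eta> i else \<nu> i)"
    have sub': "set_pmf (\<nu>' i) \<subseteq> set_pmf (\<nu> i)" for i using \<eta>(1) by (auto simp: \<nu>'_def)
    have "(\<Sum>i\<in>UNIV. mean (\<nu>' i) id) =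
       (\<Sum>i\<in>UNIV. mean (\<nu> i) id + (if i \<in> I then t *\<^sub>R (\<bar>c i\<bar> *\<^sub>R (a' i - b' i)) else 0))"
      by (intro sum.cong) (auto simp: \<nu>'_def \<eta>(2))
    also have "\<dots> = (\<Sum>i\<in>UNIV. mean (\<nu> i) id) + t *\<^sub>R (\<Sum>i\<in>I. \<bar>c i\<bar> *\<^sub>R (a' i - b' i))"
      by (simp add: sum.distrib sum.If_cases scaleR_sum_right)
    finally have "(\<Sum>i\<in>UNIV. mean (\<nu>' i) id) = (\<Sum>i\<in>UNIV. mean (\<nu> i) id)" by (simp add: c')
    then have "P \<nu>'" using P sub' sub finite_subset[OF sub' fin]
      unfolding P_def fin_prob_def by (metis (mono_tags, lifting) mem_Collect_eq subset_trans)
    moreover have "size \<nu>' < size \<nu>"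
      unfolding size_def
    proof (rule sum_strict_mono_ex1)
      show "\<forall>i\<in>UNIV. card (set_pmf (\<nu>' i)) \<le> card (set_pmf (\<nu> i))"
        using sub' fin by (auto intro: card_mono)
      have kI: "k \<in> I" "c k \<noteq> 0" using k by (auto simp: I'_def)
      then have "b' k \<notin> set_pmf (\<nu>' k)" using k(2) \<eta>(3)[of k] by (simp add: \<nu>'_def)
      then have "set_pmf (\<nu>' k) \<subset> set_pmf (\<nu> k)" using sub' ab'(2)[OF kI(1)] by blast
      then show "\<exists>i\<in>UNIV. card (set_pmf (\<nu>' i)) < card (set_pmf (\<nu> i))"
        using psubset_card_mono[OF fin] by blast
    qed simp
    ultimately show False using least by fastforce
  qed
  then show ?thesis using P by (auto simp: P_def I_def)
qed

section \<open>Minimization over bounded closed convex sets\<close>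

text \<open>A substitute for weak compactness: points of nearly minimal norm in the successive sets
  form a Cauchy sequence by the parallelogram law.\<close>

lemma decseq_closed_convex_Inter_nonempty:
  fixes C :: "nat \<Rightarrow> 'a::{real_inner,complete_space} set"
  assumes ne: "\<And>n. C n \<noteq> {}" and cl: "\<And>n. closed (C n)" and cv: "\<And>n. convex (C n)"
    and dec: "decseq C" and bd: "bounded (C 0)"
  obtains z where "\<And>n. z \<in> C n"
proof -
  \<comment> \<open>The distance from the origin to \<open>C n\<close>. It increases with
    \<open>n\<close> and is bounded because \<open>C 0\<close> is, hence converges.\<close>
  define d where "d = (\<lambda>n. Inf (norm ` C n))"
  have bb: "bdd_below (norm ` C n)" for n by (rule bdd_belowI[of _ 0]) auto
  have d_le: "d n \<le> norm x" if "x \<in> C n" for n x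
    unfolding d_def using that bb by (intro cInf_lower) auto
  have d0: "0 \<le> d n" for n unfolding d_def using ne by (intro cInf_greatest) auto
  have sub: "C m \<subseteq> C n" if "n \<le> m" for m n using dec that by (auto simp: decseq_def)
  have "incseq d"
    unfolding incseq_def d_def using sub ne bb by (auto intro!: cInf_superset_mono image_mono)
  obtain R where R: "\<And>x. x \<in> C 0 \<Longrightarrow> norm x \<le> R" using bd by (auto simp: bounded_iff)
  have "d n \<le> R" for n using ne[of n] sub[of 0 n] R d_le[of _ n] by fastforce
  then obtain l where l: "d \<longlonglongrightarrow> l" using incseq_convergent[OF \<open>incseq d\<close>, of R] by blast
  have "\<exists>x\<in>C n. norm x < d n + 1 / real (Suc n)" for n
    using cInf_lessD[of "norm ` C n" "d n + 1 / real (Suc n)"] ne by (auto simp: d_def)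
  then obtain z where z: "\<And>n. z n \<in> C n" "\<And>n. norm (z n) < d n + 1 / real (Suc n)" by metis
  have nl: "(\<lambda>n. norm (z n)) \<longlonglongrightarrow> l"
  proof (rule tendsto_sandwich[OF _ _ l])
    show "\<forall>\<^sub>F n in sequentially. d n \<le> norm (z n)" using d_le z(1) by simp
    show "\<forall>\<^sub>F n in sequentially. norm (z n) \<le> d n + 1 / real (Suc n)" using z(2) by (simp add: less_imp_le)
    show "(\<lambda>n. d n + 1 / real (Suc n)) \<longlonglongrightarrow> l"
      using tendsto_add[OF l LIMSEQ_inverse_real_of_nat] by (simp add: inverse_eq_divide)
  qed
  \<comment> \<open>Both points lie in \<open>C n\<close>, so their midpoint does too and has norm
    at least \<open>d n\<close>; the parallelogram law does the rest.\<close>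
  have dist: "(dist (z m) (z n))\<^sup>2 \<le> 2 * (norm (z m))\<^sup>2 + 2 * (norm (z n))\<^sup>2 - 4 * (d n)\<^sup>2" if "n \<le> m" for m n
  proof -
    have "(1/2) *\<^sub>R z m + (1/2) *\<^sub>R z n \<in> C n"
      using cv[of n] z(1) sub[OF that] by (intro convexD) auto
    then have "(d n)\<^sup>2 \<le> (norm ((1/2) *\<^sub>R z m + (1/2) *\<^sub>R z n))\<^sup>2"
      using d_le d0 by (intro power_mono) auto
    moreover have "(dist (z m) (z n))\<^sup>2 = 2 * (norm (z m))\<^sup>2 + 2 * (norm (z n))\<^sup>2
        - 4 * (norm ((1/2) *\<^sub>R z m + (1/2) *\<^sub>R z n))\<^sup>2"
      unfolding dist_norm power2_norm_eq_inner
      by (simp add: inner_diff_left inner_diff_right inner_add_left inner_add_right inner_commute)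
    ultimately show ?thesis by linarith
  qed
  have "Cauchy z"
  proof (rule metric_CauchyI)
    fix e :: real assume e: "0 < e"
    \<comment> \<open>With both squared norms below \<open>l\<^sup>2 + h\<close> and
      \<open>(d n)\<^sup>2\<close> above \<open>l\<^sup>2 - h\<close>, the bound \<open>dist\<close>
      totals \<open>8 * h\<close>, that is, \<open>e\<^sup>2\<close>.\<close>
    define h where "h = e\<^sup>2 / 8"
    have "h > 0" using e by (simp add: h_def)
    have "(\<lambda>n. (norm (z n))\<^sup>2) \<longlonglongrightarrow> l\<^sup>2" "(\<lambda>n. (d n)\<^sup>2) \<longlonglongrightarrow> l\<^sup>2"
      using nl l by (auto intro: tendsto_power)
    then have "\<forall>\<^sub>F n in sequentially. (norm (z n))\<^sup>2 < l\<^sup>2 + h" "\<forall>\<^sub>F n in sequentially. (d n)\<^sup>2 > l\<^sup>2 - h"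
      using \<open>h > 0\<close> by (auto intro: order_tendstoD)
    then have "\<forall>\<^sub>F n in sequentially. (norm (z n))\<^sup>2 < l\<^sup>2 + h \<and> (d n)\<^sup>2 > l\<^sup>2 - h" by (rule eventually_conj)
    then obtain K where K: "\<And>n. n \<ge> K \<Longrightarrow> (norm (z n))\<^sup>2 < l\<^sup>2 + h \<and> (d n)\<^sup>2 > l\<^sup>2 - h"
      by (auto simp: eventually_sequentially)
    have main: "dist (z m) (z n) < e" if "K \<le> n" "n \<le> m" for m n
    proof -
      have "(dist (z m) (z n))\<^sup>2 < e\<^sup>2"
        using dist[OF that(2)] K[of n] K[of m] that by (simp add: h_def)
      then show ?thesis using e by (simp add: power_less_imp_less_base)
    qed
    then show "\<exists>M. \<forall>m\<ge>M. \<forall>n\<ge>M. dist (z m) (z n) < e"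
      by (metis dist_commute nle_le)
  qed
  then obtain y where y: "z \<longlonglongrightarrow> y" using Cauchy_convergent_iff convergentD by blast
  \<comment> \<open>From index \<open>n\<close> on the sequence stays in \<open>C n\<close>; the
    shift discards the earlier terms.\<close>
  have "y \<in> C n" for n
  proof (rule closed_sequentially[OF cl, of "\<lambda>k. z (k + n)" n])
    show "\<And>k. z (k + n) \<in> C n" using z(1) sub[of n] by (meson le_add2 subsetD)
    show "(\<lambda>k. z (k + n)) \<longlonglongrightarrow> y" using y by (rule LIMSEQ_ignore_initial_segment)
  qed
  then show ?thesis using that by blast
qed

text \<open>An affine minorant touching \<open>F\<close> at each point of \<open>C\<close> makes the
  sublevel sets closed and convex, so those at levels decreasing to the infimum have a common
  point.\<close>

lemma subdifferentiable_attains_min: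
  fixes F :: "'a::{real_inner,complete_space} \<Rightarrow> real"
  assumes ne: "C \<noteq> {}" and cl: "closed C" and cv: "convex C" and bd: "bounded C"
    and sub: "\<And>y. y \<in> C \<Longrightarrow> \<exists>v. \<forall>z\<in>C. F y + v \<bullet> (z - y) \<le> F z"
  obtains y where "y \<in> C" "\<And>z. z \<in> C \<Longrightarrow> F y \<le> F z"
proof -
  obtain R where R: "\<And>x. x \<in> C \<Longrightarrow> norm x \<le> R" using bd by (auto simp: bounded_iff)
  obtain x0 where x0: "x0 \<in> C" using ne by auto
  have bb: "bdd_below (F ` C)"
  proof -
    obtain v where v: "\<forall>z\<in>C. F x0 + v \<bullet> (z - x0) \<le> F z" using sub[OF x0] by auto
    have "F x0 - norm v * (R + R) \<le> F z" if "z \<in> C" for z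
    proof -
      have "\<bar>v \<bullet> (z - x0)\<bar> \<le> norm v * norm (z - x0)" by (rule Cauchy_Schwarz_ineq2)
      also have "\<dots> \<le> norm v * (R + R)"
        using R[OF that] R[OF x0] norm_triangle_ineq4[of z x0] by (intro mult_left_mono) auto
      finally show ?thesis using v that by force
    qed
    then show ?thesis by (intro bdd_belowI2)
  qed
  define m where "m = Inf (F ` C)"
  have m_le: "m \<le> F z" if "z \<in> C" for z unfolding m_def using that bb by (intro cInf_lower) auto
  define S where "S = (\<lambda>n. {y \<in> C. F y \<le> m + 1 / real (Suc n)})"
  obtain y where y: "\<And>n. y \<in> S n"
  proof (rule decseq_closed_convex_Inter_nonempty[of S])
    show "S n \<noteq> {}" for n
      using cInf_lessD[of "F ` C" "m + 1 / real (Suc n)"] ne by (force simp: S_def m_def)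
    show "closed (S n)" for n
      unfolding closed_sequential_limits
    proof (intro allI impI, elim conjE)
      fix x l assume x: "\<forall>k. x k \<in> S n" and l: "x \<longlonglongrightarrow> l"
      have lC: "l \<in> C" using closed_sequentially[OF cl _ l] x by (auto simp: S_def)
      \<comment> \<open>The minorant at the limit point \<open>l\<close> is continuous, so the level
        bound passes to the limit without continuity of \<open>F\<close>.\<close>
      obtain v where v: "\<forall>z\<in>C. F l + v \<bullet> (z - l) \<le> F z" using sub[OF lC] by auto
      have "(\<lambda>k. F l + v \<bullet> (x k - l)) \<longlonglongrightarrow> F l + v \<bullet> (l - l)" by (intro tendsto_intros l)
      moreover have "F l + v \<bullet> (x k - l) \<le> m + 1 / real (Suc n)" for k
        using bspec[OF v, of "x k"] x by (simp add: S_def) (meson order_trans)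
      ultimately have "F l + v \<bullet> (l - l) \<le> m + 1 / real (Suc n)"
        by (blast intro: LIMSEQ_le_const2)
      then show "l \<in> S n" using lC by (simp add: S_def)
    qed
    show "convex (S n)" for n
      unfolding convex_alt
    proof (intro ballI allI impI)
      fix x y t assume xy: "x \<in> S n" "y \<in> S n" and t: "0 \<le> t \<and> t \<le> (1::real)"
      define w where "w = (1 - t) *\<^sub>R x + t *\<^sub>R y"
      have wC: "w \<in> C" unfolding w_def using xy t cv by (auto simp: S_def convex_alt)
      \<comment> \<open>With the minorant taken at the convex combination \<open>w\<close> itself,
        the displacements \<open>x - w\<close> and \<open>y - w\<close> cancel under the weights
        \<open>1 - t\<close> and \<open>t\<close>, leaving \<open>F w\<close>.\<close>
      obtain v where v: "\<forall>z\<in>C. F w + v \<bullet> (z - w) \<le> F z" using sub[OF wC] by auto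
      define r where "r = m + 1 / real (Suc n)"
      have "F w + v \<bullet> (x - w) \<le> r" "F w + v \<bullet> (y - w) \<le> r"
        using v xy by (force simp: S_def r_def)+
      then have "(1 - t) * (F w + v \<bullet> (x - w)) + t * (F w + v \<bullet> (y - w)) \<le> (1 - t) * r + t * r"
        using t by (intro add_mono mult_left_mono) auto
      moreover have "(1 - t) * (F w + v \<bullet> (x - w)) + t * (F w + v \<bullet> (y - w)) = F w"
      proof -
        have "(1 - t) * (v \<bullet> (x - w)) + t * (v \<bullet> (y - w)) = v \<bullet> ((1 - t) *\<^sub>R (x - w) + t *\<^sub>R (y - w))"
          by (simp add: inner_add_right)
        also have "(1 - t) *\<^sub>R (x - w) + t *\<^sub>R (y - w) = 0" by (simp add: w_def algebra_simps)
        finally show ?thesis by (simp add: algebra_simps)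
      qed
      ultimately have "F w \<le> r" by (simp add: algebra_simps)
      then show "(1 - t) *\<^sub>R x + t *\<^sub>R y \<in> S n" using wC by (simp add: S_def w_def r_def)
    qed
    show "decseq S"
      unfolding decseq_Suc_iff
    proof (intro allI subsetI)
      fix n x assume "x \<in> S (Suc n)"
      moreover have "1 / real (Suc (Suc n)) \<le> 1 / real (Suc n)" by (intro divide_left_mono) auto
      ultimately show "x \<in> S n" by (simp add: S_def)
    qed
    show "bounded (S 0)" by (rule bounded_subset[OF bd]) (auto simp: S_def)
  qed auto
  have "F y \<le> m"
  proof (rule LIMSEQ_le_const)
    show "(\<lambda>n. m + 1 / real (Suc n)) \<longlonglongrightarrow> m"
      using tendsto_add[OF tendsto_const LIMSEQ_inverse_real_of_nat, of m] by (simp add: inverse_eq_divide)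
    show "\<exists>N. \<forall>n\<ge>N. F y \<le> m + 1 / real (Suc n)" using y by (auto simp: S_def)
  qed
  then show ?thesis using that[of y] y m_le by (force simp: S_def)
qed

section \<open>Minimizing supports, near-optimal variances and Minkowski averages\<close>

lemma var_return_pmf [simp]: "var (return_pmf a) F = 0"
  by (simp add: var_def)

lemma return_pmf_in_fin_prob: "a \<in> A \<Longrightarrow> return_pmf a \<in> fin_prob A"
  by (simp add: fin_prob_def)

text \<open>The deviations \<open>l \<bullet> x - l \<bullet> mean \<mu> id\<close> are nonnegative
  on the support and average to zero, so they vanish there.\<close>

lemma minimizing_mean_support:
  fixes l :: "'a::real_inner"
  assumes \<mu>: "\<mu> \<in> fin_prob A" and le: "\<And>a. a \<in> A \<Longrightarrow> l \<bullet> mean \<mu> id \<le> l \<bullet> a"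
  shows "\<mu> \<in> fin_prob (argmin_set (\<lambda>y. l \<bullet> y) A)"
proof -
  let ?m = "l \<bullet> mean \<mu> id"
  have fin: "finite (set_pmf \<mu>)" and sub: "set_pmf \<mu> \<subseteq> A" using \<mu> by (auto simp: fin_prob_def)
  have "(\<Sum>x\<in>set_pmf \<mu>. pmf \<mu> x * (l \<bullet> x - ?m)) = ?m - (\<Sum>x\<in>set_pmf \<mu>. pmf \<mu> x) * ?m"
    by (subst (2) inner_mean) (simp add: right_diff_distrib sum_subtractf sum_distrib_right)
  also have "\<dots> = 0" using sum_pmf_set_pmf[OF fin] by simp
  finally have "\<forall>x\<in>set_pmf \<mu>. pmf \<mu> x * (l \<bullet> x - ?m) = 0"
    using fin sub le by (subst (asm) sum_nonneg_eq_0_iff) auto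
  then have "l \<bullet> x = ?m" if "x \<in> set_pmf \<mu>" for x using that by (auto simp: set_pmf_iff)
  then show ?thesis
    using fin sub le by (fastforce simp: fin_prob_def argmin_set_def is_arg_min_def not_less)
qed

lemma ereal_sqrt_square: "0 \<le> s \<Longrightarrow> (ereal_sqrt s)\<^sup>2 = s"
  by (cases s) (auto simp: ereal_sqrt_def power2_eq_square)

text \<open>The witness \<open>v\<close> is the least variance at mean \<open>y\<close>, as an
  infimum that may fail to be attained; hence the slack \<open>e\<close>. It is a real number even
  if \<open>rho K\<close> is infinite, since some distribution on \<open>K\<close> has mean
  \<open>y\<close>.\<close>

lemma near_rho_pmf:
  fixes K :: "'a::real_inner set"
  assumes y: "y \<in> convex hull K"
  obtains v where "0 \<le> v" "ereal v \<le> (rho K)\<^sup>2"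
    "\<And>e. 0 < e \<Longrightarrow> \<exists>\<mu>\<in>fin_prob K. mean \<mu> id = y \<and> var \<mu> id < v + e"
proof -
  define V where "V = (\<lambda>y. INF \<mu>\<in>{\<mu> \<in> fin_prob K. mean \<mu> id = y}. ereal (var \<mu> id))"
  obtain \<mu>0 where \<mu>0: "\<mu>0 \<in> fin_prob K" "mean \<mu>0 id = y" using convex_hull_pmf[OF y] .
  have "0 \<le> V y" unfolding V_def by (intro INF_greatest) (simp add: var_nonneg)
  moreover have "V y \<le> ereal (var \<mu>0 id)" unfolding V_def using \<mu>0 by (intro INF_lower) simp
  ultimately obtain v where v: "V y = ereal v" "0 \<le> v" by (cases "V y") auto
  have "V y \<le> (SUP y\<in>convex hull K. V y)" using y by (rule SUP_upper)
  moreover from this have "0 \<le> (SUP y\<in>convex hull K. V y)" using \<open>0 \<le> V y\<close> by (rule order_trans[rotated])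
  ultimately have "ereal v \<le> (rho K)\<^sup>2" using v by (simp add: rho_def V_def ereal_sqrt_square)
  moreover have "\<exists>\<mu>\<in>fin_prob K. mean \<mu> id = y \<and> var \<mu> id < v + e" if "0 < e" for e
  proof -
    have "V y < ereal (v + e)" using v that by simp
    then show ?thesis unfolding V_def INF_less_iff by auto
  qed
  ultimately show ?thesis using that v(2) by blast
qed

lemma set_avg_eq: "set_avg A = avg ` (\<Pi> i\<in>UNIV. A i)"
proof -
  have "(\<Sum>i\<in>UNIV. A i) = (\<lambda>s. \<Sum>i\<in>UNIV. s i) ` (\<Pi> i\<in>UNIV. A i)"
    by (auto simp: set_sum_alt Pi_def)
  then show ?thesis by (simp add: set_avg_def avg_def image_image)
qed

lemma convex_hull_set_avg: "convex hull (set_avg A) = set_avg (\<lambda>i. convex hull A i)"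
  unfolding set_avg_def by (simp add: convex_hull_scaling convex_hull_set_sum)

lemma avg_fun_upd:
  fixes s :: "'n::finite \<Rightarrow> 'a::real_vector"
  shows "avg (s(i := a)) = avg s + (1 / real CARD('n)) *\<^sub>R (a - s i)"
proof -
  have "(\<Sum>k\<in>UNIV. (s(i := a)) k) = (\<Sum>k\<in>UNIV. s k + (if k = i then a - s i else 0))"
    by (intro sum.cong) auto
  then show ?thesis by (simp add: avg_def sum.distrib scaleR_right_distrib)
qed

text \<open>Replacing only the \<open>i\<close>-th summand stays inside the Minkowski average, so a
  linear minimization over the average splits into the components.\<close>

lemma avg_minimizer_component:
  fixes s :: "'n::finite \<Rightarrow> 'a::real_inner"
  assumes s: "\<And>i. s i \<in> B i"
    and min: "\<And>z. z \<in> set_avg B \<Longrightarrow> v \<bullet> avg s \<le> v \<bullet> z" and a: "a \<in> B i"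
  shows "v \<bullet> s i \<le> v \<bullet> a"
proof -
  have "avg (s(i := a)) \<in> set_avg B" unfolding set_avg_eq using s a by auto
  from min[OF this] show ?thesis
    by (simp add: avg_fun_upd inner_add_right inner_diff_right zero_le_divide_iff)
qed

lemma inner_avg:
  fixes s :: "'n::finite \<Rightarrow> 'a::real_inner"
  shows "v \<bullet> avg s = (\<Sum>i\<in>UNIV. v \<bullet> s i) / real CARD('n)"
  by (simp add: avg_def inner_sum_right)

section \<open>Duality and rounding\<close>

text \<open>The dual objective in terms of the image sets \<open>Y i\<close> alone, so that duality
  can be argued without the decision variables and the block structure.\<close>

definition lagrange_dual :: "('n::finite \<Rightarrow> 'a::real_inner set) \<Rightarrow> 'a set \<Rightarrow> ('a \<Rightarrow> real) \<Rightarrow> 'a \<Rightarrow> ereal" where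
  "lagrange_dual Y H F l = - fenchel_conj H F l
     + ereal (1 / real CARD('n)) * (\<Sum>i\<in>UNIV. INF y\<in>Y i. ereal (l \<bullet> y))"

text \<open>The subgradient inequality bounds the conjugate at \<open>v\<close> by
  \<open>v \<bullet> avg s - F (avg s)\<close>, and minimality of each \<open>s i\<close> bounds the
  infima from below. The two linear contributions cancel.\<close>

lemma primal_le_lagrange_dual:
  fixes Y :: "'n::finite \<Rightarrow> 'a::real_inner set"
  assumes sub: "\<And>z. z \<in> H \<Longrightarrow> F (avg s) + v \<bullet> (z - avg s) \<le> F z"
    and min: "\<And>i a. a \<in> Y i \<Longrightarrow> v \<bullet> s i \<le> v \<bullet> a"
  shows "ereal (F (avg s)) \<le> lagrange_dual Y H F v"
proof -
  have "fenchel_conj H F v \<le> ereal (v \<bullet> avg s - F (avg s))"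
    unfolding fenchel_conj_def using sub by (intro SUP_least) (force simp: inner_diff_right)
  then have 1: "ereal (F (avg s) - v \<bullet> avg s) \<le> - fenchel_conj H F v"
    by (cases "fenchel_conj H F v") auto
  have "ereal (\<Sum>i\<in>UNIV. v \<bullet> s i) \<le> (\<Sum>i\<in>UNIV. INF y\<in>Y i. ereal (v \<bullet> y))"
    unfolding sum_ereal[symmetric] using min by (intro sum_mono INF_greatest) auto
  then have "ereal (1 / real CARD('n)) * ereal (\<Sum>i\<in>UNIV. v \<bullet> s i)
     \<le> ereal (1 / real CARD('n)) * (\<Sum>i\<in>UNIV. INF y\<in>Y i. ereal (v \<bullet> y))"
    by (intro ereal_mult_left_mono) auto
  then have "ereal (v \<bullet> avg s) \<le> ereal (1 / real CARD('n)) * (\<Sum>i\<in>UNIV. INF y\<in>Y i. ereal (v \<bullet> y))"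
    by (simp add: inner_avg)
  from add_mono[OF 1 this] show ?thesis by (simp add: lagrange_dual_def)
qed

text \<open>Weak duality adds up the Fenchel--Young inequality and one inequality
  \<open>\<phi> i \<le> l \<bullet> s i\<close> for each index. Absence of a gap forces each of them
  to be an equality.\<close>

lemma lagrange_dual_complementarity:
  fixes Y :: "'n::finite \<Rightarrow> 'a::real_inner set"
  assumes sY: "\<And>i. s i \<in> convex hull Y i" and sH: "avg s \<in> H"
    and dual: "ereal (F (avg s)) \<le> lagrange_dual Y H F l" and a: "a \<in> Y k"
  shows "l \<bullet> s k \<le> l \<bullet> a"
proof -
  define \<phi> where "\<phi> = (\<lambda>i. INF y\<in>Y i. ereal (l \<bullet> y))"
  have \<phi>: "\<phi> i \<le> ereal (l \<bullet> s i)" for i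
  proof -
    \<comment> \<open>The point \<open>s i\<close> lies only in the hull, whereas the infimum runs
      over \<open>Y i\<close>. Some support point has at most the mean value of the linear
      functional.\<close>
    obtain \<mu> where \<mu>: "\<mu> \<in> fin_prob (Y i)" "mean \<mu> id = s i" using convex_hull_pmf[OF sY] .
    then obtain z where "z \<in> set_pmf \<mu>" "l \<bullet> z \<le> l \<bullet> s i"
      using pmf_le_mean[of \<mu> "\<lambda>z. l \<bullet> z"] inner_mean[of l \<mu> id] by (auto simp: fin_prob_def)
    then show ?thesis using \<mu> unfolding \<phi>_def by (intro INF_lower2[of z]) (auto simp: fin_prob_def)
  qed
  have "ereal (l \<bullet> avg s - F (avg s)) \<le> fenchel_conj H F l"
    unfolding fenchel_conj_def using sH by (intro SUP_upper) auto
  then have "- fenchel_conj H F l \<le> ereal (F (avg s) - l \<bullet> avg s)"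
    by (cases "fenchel_conj H F l") auto
  then have "lagrange_dual Y H F l \<le> ereal (F (avg s) - l \<bullet> avg s) + ereal (1 / real CARD('n)) * sum \<phi> UNIV"
    unfolding lagrange_dual_def \<phi>_def by (rule add_right_mono)
  with dual have *: "ereal (F (avg s)) \<le> ereal (F (avg s) - l \<bullet> avg s) + ereal (1 / real CARD('n)) * sum \<phi> UNIV"
    by (rule order_trans)
  have "ereal (\<Sum>i\<in>UNIV. l \<bullet> s i) \<le> sum \<phi> UNIV"
    using * by (cases "sum \<phi> UNIV") (auto simp: inner_avg field_simps)
  \<comment> \<open>Estimating every term but the \<open>k\<close>-th from above leaves the reverse
    inequality for \<open>\<phi> k\<close>.\<close>
  also have "sum \<phi> UNIV = \<phi> k + sum \<phi> (UNIV - {k})" by (rule sum.remove) auto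
  also have "\<dots> \<le> \<phi> k + ereal (\<Sum>i\<in>UNIV - {k}. l \<bullet> s i)"
    unfolding sum_ereal[symmetric] using \<phi> by (intro add_left_mono sum_mono)
  finally have "ereal (l \<bullet> s k) \<le> \<phi> k"
    by (subst (asm) sum.remove[of _ k]) (auto, cases "\<phi> k", auto)
  also have "\<phi> k \<le> ereal (l \<bullet> a)" unfolding \<phi>_def using a by (rule INF_lower)
  finally show ?thesis by simp
qed

text \<open>Coordinates outside \<open>Q\<close> are kept; those in \<open>Q\<close> are replaced by
  support points of nearly optimal distributions. The linear term of the upper bound is controlled
  together with the quadratic one by the selection of points, so only variances remain.\<close>

lemma rounding_bound:
  fixes A :: "'n::finite \<Rightarrow> 'a::real_inner set"
  assumes y: "\<And>i. y i \<in> convex hull A i" and Q: "\<And>i. i \<notin> Q \<Longrightarrow> y i \<in> A i"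
    and up: "\<And>z. z \<in> set_avg A \<Longrightarrow> F z \<le> F (avg y) + v \<bullet> (z - avg y) + (norm (z - avg y))\<^sup>2 / 2"
  shows "(INF z\<in>Pi UNIV A. ereal (F (avg z))) \<le> ereal (F (avg y)) +
    ereal (1 / (2 * (real CARD('n))\<^sup>2)) * (\<Sum>i\<in>Q. (rho (A i))\<^sup>2)"
proof -
  define N where "N = real CARD('n)"
  have N: "N \<ge> 1" unfolding N_def by (simp add: Suc_leI)
  have "\<exists>v\<ge>0. ereal v \<le> (rho (A i))\<^sup>2 \<and>
      (\<forall>e>0. \<exists>\<mu>\<in>fin_prob (A i). mean \<mu> id = y i \<and> var \<mu> id < v + e)" for i
    using near_rho_pmf[OF y[of i]] by metis
  then obtain r where r: "\<And>i. ereal (r i) \<le> (rho (A i))\<^sup>2"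
    "\<And>i e. e > 0 \<Longrightarrow> \<exists>\<mu>\<in>fin_prob (A i). mean \<mu> id = y i \<and> var \<mu> id < r i + e" by metis
  define R where "R = (\<Sum>i\<in>Q. r i)"
  have "(INF z\<in>Pi UNIV A. ereal (F (avg z))) \<le> ereal (F (avg y) + 1 / (2 * N\<^sup>2) * R) + ereal e" if "e > 0" for e
  proof -
    \<comment> \<open>Outside \<open>Q\<close> a Dirac distribution has variance zero, so the slack
      \<open>e\<close> is spent only on \<open>Q\<close>.\<close>
    have "\<exists>\<mu>\<in>fin_prob (A i). mean \<mu> id = y i \<and> var \<mu> id \<le> (if i \<in> Q then r i + e else 0)" for i
      using r(2)[OF that, of i] Q[of i]
      by (cases "i \<in> Q") (force intro: less_imp_le, force intro!: bexI[of _ "return_pmf (y i)"] return_pmf_in_fin_prob)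
    then obtain \<mu> where \<mu>: "\<And>i. \<mu> i \<in> fin_prob (A i)" "\<And>i. mean (\<mu> i) id = y i"
      "\<And>i. var (\<mu> i) id \<le> (if i \<in> Q then r i + e else 0)" by metis
    \<comment> \<open>The factor \<open>2 * N\<close> is chosen so that multiplication by
      \<open>1 / (2 * N\<^sup>2)\<close> returns exactly
      \<open>v \<bullet> (1 / N) *\<^sub>R d\<close> plus half the squared norm of
      \<open>(1 / N) *\<^sub>R d\<close>.\<close>
    obtain z where z: "\<And>i. z i \<in> set_pmf (\<mu> i)" and zle:
      "(2 * N) *\<^sub>R v \<bullet> (\<Sum>i\<in>UNIV. z i - y i) + (norm (\<Sum>i\<in>UNIV. z i - y i))\<^sup>2 \<le> (\<Sum>i\<in>UNIV. var (\<mu> i) id)"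
      using select_points[of UNIV \<mu> "(2 * N) *\<^sub>R v"] \<mu>(1) unfolding \<mu>(2) fin_prob_def by auto
    define d where "d = (\<Sum>i\<in>UNIV. z i - y i)"
    have zA: "z \<in> Pi UNIV A" using z \<mu>(1) by (auto simp: fin_prob_def)
    have "avg z - avg y = (1 / N) *\<^sub>R d"
      by (simp add: avg_def d_def N_def sum_subtractf scaleR_right_diff_distrib)
    then have "F (avg z) \<le> F (avg y) + v \<bullet> (1 / N) *\<^sub>R d + (norm ((1 / N) *\<^sub>R d))\<^sup>2 / 2"
      using up[of "avg z"] zA by (simp add: set_avg_eq)
    also have "\<dots> = F (avg y) + 1 / (2 * N\<^sup>2) * ((2 * N) *\<^sub>R v \<bullet> d + (norm d)\<^sup>2)"
      using N by (simp add: field_simps power2_eq_square)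
    also have "\<dots> \<le> F (avg y) + 1 / (2 * N\<^sup>2) * (R + N * e)"
    proof -
      have "(\<Sum>i\<in>UNIV. var (\<mu> i) id) \<le> (\<Sum>i\<in>UNIV. if i \<in> Q then r i + e else 0)"
        using \<mu>(3) by (rule sum_mono)
      also have "\<dots> = R + real (card Q) * e" by (simp add: sum.If_cases R_def sum.distrib)
      also have "\<dots> \<le> R + N * e"
        using that by (auto simp: N_def intro!: mult_right_mono card_mono)
      finally have "(2 * N) *\<^sub>R v \<bullet> d + (norm d)\<^sup>2 \<le> R + N * e" using zle unfolding d_def by linarith
      then show ?thesis by (intro add_left_mono mult_left_mono) auto
    qed
    \<comment> \<open>The accumulated slack is \<open>e / (2 * N)\<close>, at most \<open>e\<close>,
      which then tends to zero.\<close>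
    also have "\<dots> \<le> F (avg y) + 1 / (2 * N\<^sup>2) * R + e"
    proof -
      have "1 / (2 * N\<^sup>2) * (N * e) = (1 / (2 * N)) * e" using N by (simp add: power2_eq_square)
      also have "\<dots> \<le> 1 * e" using N that by (intro mult_right_mono) (auto simp: field_simps)
      finally show ?thesis by (simp add: distrib_left)
    qed
    finally show ?thesis using zA by (intro INF_lower2[of z]) auto
  qed
  then have "(INF z\<in>Pi UNIV A. ereal (F (avg z))) \<le> ereal (F (avg y) + 1 / (2 * N\<^sup>2) * R)"
    by (rule ereal_le_epsilon2)
  also have "\<dots> = ereal (F (avg y)) + ereal (1 / (2 * N\<^sup>2)) * (\<Sum>i\<in>Q. ereal (r i))"
    by (simp add: R_def)
  also have "\<dots> \<le> ereal (F (avg y)) + ereal (1 / (2 * N\<^sup>2)) * (\<Sum>i\<in>Q. (rho (A i))\<^sup>2)"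
    using r(1) by (intro add_left_mono ereal_mult_left_mono sum_mono) auto
  finally show ?thesis by (simp add: N_def)
qed

text \<open>One subspace and one function suffice here; blocks and rescaling enter later. The
  hypothesis \<open>grad\<close> asks for an affine minorant on all of \<open>H\<close>, as the
  conjugate is a supremum over \<open>H\<close>, but for the quadratic upper bound only on
  \<open>C\<close>.\<close>

theorem decomposition_bound:
  fixes Y :: "'n::finite \<Rightarrow> 'a::{real_inner,complete_space} set" and F :: "'a \<Rightarrow> real"
  defines "C \<equiv> convex hull set_avg Y"
  assumes ne: "\<And>i. Y i \<noteq> {}" and bd: "\<And>i. bounded (Y i)" and H: "subspace H" "\<And>i. Y i \<subseteq> H"
    and cl: "closed C"
    and grad: "\<And>y. y \<in> C \<Longrightarrow> \<exists>v\<in>H. (\<forall>z\<in>H. F y + v \<bullet> (z - y) \<le> F z) \<and>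
      (\<forall>z\<in>C. F z \<le> F y + v \<bullet> (z - y) + (norm (z - y))\<^sup>2 / 2)"
    and dual: "\<And>l'. l' \<in> H \<Longrightarrow> lagrange_dual Y H F l' \<le> lagrange_dual Y H F l"
  obtains y where "y \<in> C" "\<And>z. z \<in> C \<Longrightarrow> F y \<le> F z"
    "(INF z\<in>(\<Pi> i\<in>UNIV. argmin_set (\<lambda>y. l \<bullet> y) (Y i)). ereal (F (avg z))) \<le> ereal (F y) +
     ereal (1 / (2 * (real CARD('n))\<^sup>2)) *
       (MAX Q\<in>{Q. enat (card Q) = min (edim H) (enat CARD('n))}.
          \<Sum>i\<in>Q. (rho (argmin_set (\<lambda>y. l \<bullet> y) (Y i)))\<^sup>2)"
proof -
  define A where "A = (\<lambda>i. argmin_set (\<lambda>y. l \<bullet> y) (Y i))"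
  have AY: "A i \<subseteq> Y i" for i by (auto simp: A_def argmin_set_def is_arg_min_def)
  have C_eq: "C = set_avg (\<lambda>i. convex hull Y i)" by (simp add: C_def convex_hull_set_avg)
  have CH: "C \<subseteq> H"
  proof -
    have "set_avg Y \<subseteq> H" using H by (auto simp: set_avg_eq avg_def intro!: subspace_scale subspace_sum)
    then show ?thesis unfolding C_def using H(1) by (intro hull_minimal subspace_imp_convex)
  qed
  have bdC: "bounded C"
  proof -
    have "\<forall>i. \<exists>b. \<forall>x\<in>Y i. norm x \<le> b" using bd by (simp add: bounded_iff)
    then obtain b where b: "\<And>i x. x \<in> Y i \<Longrightarrow> norm x \<le> b i" by metis
    have "bounded (set_avg Y)"
      unfolding bounded_iff set_avg_eq
      by (intro exI[of _ "1 / real CARD('n) * (\<Sum>i\<in>UNIV. b i)"])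
         (auto simp: avg_def intro!: divide_right_mono sum_norm_le b)
    then show ?thesis unfolding C_def by (rule bounded_convex_hull)
  qed
  have neC: "C \<noteq> {}" using ne by (auto simp: C_def set_avg_eq Pi_eq_empty)
  obtain y where y: "y \<in> C" and min: "\<And>z. z \<in> C \<Longrightarrow> F y \<le> F z"
    using subdifferentiable_attains_min[OF neC cl _ bdC, of F] grad CH
    by (auto simp: C_def) (metis subset_iff)
  obtain v where v: "v \<in> H" "\<And>z. z \<in> H \<Longrightarrow> F y + v \<bullet> (z - y) \<le> F z"
    "\<And>z. z \<in> C \<Longrightarrow> F z \<le> F y + v \<bullet> (z - y) + (norm (z - y))\<^sup>2 / 2" using grad[OF y] by blast
  \<comment> \<open>First-order optimality of \<open>y\<close>, obtained from the quadratic upper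
    bound along the segment from \<open>y\<close> to \<open>z\<close> instead of from a
    derivative.\<close>
  have v_min: "v \<bullet> y \<le> v \<bullet> z" if z: "z \<in> C" for z
  proof (rule ccontr)
    assume "\<not> v \<bullet> y \<le> v \<bullet> z"
    define c where "c = - (v \<bullet> (z - y))"
    define d where "d = (norm (z - y))\<^sup>2"
    \<comment> \<open>Small enough that \<open>t * d < c\<close>: the gain \<open>t * c\<close> of
      first order then beats the loss \<open>t\<^sup>2 * d / 2\<close>, contradicting
      minimality.\<close>
    define t where "t = min 1 (c / (d + 1))"
    have c: "c > 0" using \<open>\<not> v \<bullet> y \<le> v \<bullet> z\<close> by (simp add: c_def inner_diff_right)
    have d: "d \<ge> 0" by (simp add: d_def)
    have t: "0 < t" "t \<le> 1" using c d by (auto simp: t_def)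
    have "t * (d + 1) \<le> c / (d + 1) * (d + 1)" using d by (intro mult_right_mono) (auto simp: t_def)
    then have td: "t * d < c" using t d by (simp add: distrib_left[of t])
    have "(1 - t) *\<^sub>R y + t *\<^sub>R z \<in> C"
      using y z t convex_convex_hull[of "set_avg Y"] by (auto simp: C_def convex_alt)
    moreover have eq: "(1 - t) *\<^sub>R y + t *\<^sub>R z - y = t *\<^sub>R (z - y)" by (simp add: algebra_simps)
    ultimately have "F y \<le> F y + t * (v \<bullet> (z - y)) + (t * norm (z - y))\<^sup>2 / 2"
      using v(3)[of "(1 - t) *\<^sub>R y + t *\<^sub>R z"] min[of "(1 - t) *\<^sub>R y + t *\<^sub>R z"] t
      unfolding eq by simp
    then have "0 \<le> t * (t * d / 2 - c)" by (simp add: c_def d_def power_mult_distrib power2_eq_square algebra_simps)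
    then have "c \<le> t * d / 2" using t by (simp add: zero_le_mult_iff)
    then show False using td c by linarith
  qed
  obtain s where s: "\<And>i. s i \<in> convex hull Y i" "y = avg s" using y by (auto simp: C_eq set_avg_eq)
  have "v \<bullet> s i \<le> v \<bullet> a" if "a \<in> Y i" for a i
    using v_min that s unfolding C_eq
    by (intro avg_minimizer_component[of s "\<lambda>i. convex hull Y i"]) (auto intro: hull_inc)
  \<comment> \<open>The subgradient \<open>v\<close> is a dual point with value at least the primal
    minimum, so the dual maximizer \<open>l\<close> inherits this bound and complementarity applies
    to it.\<close>
  then have "ereal (F (avg s)) \<le> lagrange_dual Y H F v"
    using v(2) s(2) by (intro primal_le_lagrange_dual) auto
  also have "\<dots> \<le> lagrange_dual Y H F l" using v(1) by (rule dual)
  finally have l_min: "l \<bullet> s i \<le> l \<bullet> a" if "a \<in> Y i" for a i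
    using lagrange_dual_complementarity[where s = s, OF s(1)] CH y s(2) that by blast
  have "\<exists>\<mu>\<in>fin_prob (A i). mean \<mu> id = s i" for i
    using convex_hull_pmf[OF s(1)[of i]] minimizing_mean_support l_min unfolding A_def by metis
  then obtain \<mu> where \<mu>: "\<And>i. \<mu> i \<in> fin_prob (A i)" "\<And>i. mean (\<mu> i) id = s i" by metis
  have "\<exists>\<nu> Q. (\<forall>i. \<nu> i \<in> fin_prob (A i)) \<and> (\<Sum>i\<in>UNIV. mean (\<nu> i) id) = (\<Sum>i\<in>UNIV. mean (\<mu> i) id) \<and>
    (\<forall>i. i \<notin> Q \<longrightarrow> mean (\<nu> i) id \<in> A i) \<and> enat (card Q) = min (edim H) (enat CARD('n))"
  \<comment> \<open>In infinite dimension the prescribed cardinality is that of the whole index set,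
    so \<open>Q = UNIV\<close> works and the family can stay as it is.\<close>
  proof (cases "edim H")
    case (enat q)
    then obtain B0 where B0: "finite B0" "H \<subseteq> span B0" and q: "q = dim H"
      by (auto simp: edim_def split: if_splits)
    obtain B where B: "B \<subseteq> H" "independent B" "H \<subseteq> span B" "card B = dim H" using basis_exists by blast
    \<comment> \<open>The finite spanning set behind \<open>edim\<close> forces the basis to be
      finite, so that \<open>card B\<close> is its true size and not the default 0.\<close>
    have "finite B" using independent_span_bound[OF B0(1) B(2)] B(1) B0(2) by auto
    then obtain \<nu> where \<nu>: "\<And>i. \<nu> i \<in> fin_prob (A i)"
      "(\<Sum>i\<in>UNIV. mean (\<nu> i) id) = (\<Sum>i\<in>UNIV. mean (\<mu> i) id)" "card {i. \<forall>a. \<nu> i \<noteq> return_pmf a} \<le> card B"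
      using shapley_folkman[of \<mu> A B] \<mu>(1) AY H(2) B(3) by (metis (no_types, lifting) subset_trans)
    define I where "I = {i. \<forall>a. \<nu> i \<noteq> return_pmf a}"
    have "card I \<le> min q CARD('n)" using \<nu>(3) B(4) q by (simp add: I_def card_mono)
    \<comment> \<open>The maximum ranges over sets of one exact cardinality, so the exceptional set
      \<open>I\<close> is enlarged to that size.\<close>
    then obtain Q where Q: "I \<subseteq> Q" "card Q = min q CARD('n)"
      using exists_subset_between[of I "min q CARD('n)" UNIV] by auto
    have "mean (\<nu> i) id \<in> A i" if "i \<notin> Q" for i
    proof -
      have "i \<notin> I" using that Q(1) by blast
      then obtain a where "\<nu> i = return_pmf a" unfolding I_def by fast
      then show ?thesis using \<nu>(1)[of i] by (simp add: fin_prob_def)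
    qed
    then show ?thesis using \<nu>(1,2) Q(2) enat by (intro exI[of _ \<nu>] exI[of _ Q]) auto
  next
    case infinity
    then show ?thesis using \<mu>(1) by (intro exI[of _ \<mu>] exI[of _ UNIV]) auto
  qed
  then obtain \<nu> Q where \<nu>: "\<And>i. \<nu> i \<in> fin_prob (A i)" "\<And>i. i \<notin> Q \<Longrightarrow> mean (\<nu> i) id \<in> A i"
    and eq: "(\<Sum>i\<in>UNIV. mean (\<nu> i) id) = (\<Sum>i\<in>UNIV. s i)"
    and Q: "enat (card Q) = min (edim H) (enat CARD('n))" unfolding \<mu>(2) by metis
  have y_eq: "y = avg (\<lambda>i. mean (\<nu> i) id)" using s(2) eq by (simp add: avg_def)
  have "set_avg A \<subseteq> C" using AY unfolding C_def set_avg_eq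
    by (intro subset_trans[OF _ hull_subset] image_mono Pi_mono) auto
  then have "(INF z\<in>Pi UNIV A. ereal (F (avg z))) \<le> ereal (F y) +
    ereal (1 / (2 * (real CARD('n))\<^sup>2)) * (\<Sum>i\<in>Q. (rho (A i))\<^sup>2)"
    unfolding y_eq using \<nu> v(3) mean_in_convex_hull[OF \<nu>(1), where F = id]
    by (intro rounding_bound[where v = v]) (auto simp: y_eq)
  also have "\<dots> \<le> ereal (F y) + ereal (1 / (2 * (real CARD('n))\<^sup>2)) *
     (MAX Q\<in>{Q. enat (card Q) = min (edim H) (enat CARD('n))}. \<Sum>i\<in>Q. (rho (A i))\<^sup>2)"
    using Q by (intro add_left_mono ereal_mult_left_mono Max_ge) auto
  finally show ?thesis using that y min by (simp add: A_def)
qed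

section \<open>Gradients relative to a subspace\<close>

text \<open>Lines through points of \<open>H\<close> stay in \<open>H\<close>, so the derivative
  relative to \<open>H\<close> becomes an ordinary one in one real variable.\<close>

lemma has_gradient_line:
  assumes H: "subspace H" "a \<in> H" "b \<in> H" and grad: "has_gradient H f (b + t *\<^sub>R (a - b)) v"
  shows "((\<lambda>t. f (b + t *\<^sub>R (a - b))) has_real_derivative (a - b) \<bullet> v) (at t)"
proof -
  let ?\<phi> = "\<lambda>t. b + t *\<^sub>R (a - b)"
  have "(f has_derivative (\<lambda>h. h \<bullet> v)) (at (?\<phi> t) within H)" using grad by (simp add: has_gradient_def)
  moreover have "range ?\<phi> \<subseteq> H" using H by (auto intro!: subspace_add subspace_scale subspace_diff)
  ultimately have f': "(f has_derivative (\<lambda>h. h \<bullet> v)) (at (?\<phi> t) within range ?\<phi>)"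
    by (rule has_derivative_subset)
  have "(?\<phi> has_derivative (\<lambda>s. s *\<^sub>R (a - b))) (at t)"
    by (auto intro!: derivative_eq_intros)
  from has_derivative_in_compose[OF this f']
  have "((\<lambda>t. f (?\<phi> t)) has_derivative (\<lambda>s. s *\<^sub>R (a - b) \<bullet> v)) (at t)" .
  then show ?thesis by (simp add: has_field_derivative_def mult_commute_abs)
qed

text \<open>Gradients belong to \<open>H\<close>, so \<open>v - v'\<close> is itself an admissible
  direction. Computing the derivative along it in both ways gives it norm zero.\<close>

lemma has_gradient_unique:
  assumes H: "subspace H" "y \<in> H" and v: "has_gradient H f y v" "has_gradient H f y v'"
  shows "v = v'"
proof -
  have w: "y + (v - v') \<in> H"
    using H v by (auto simp: has_gradient_def intro!: subspace_add subspace_diff)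
  have "(v - v') \<bullet> v = (v - v') \<bullet> v'"
    using has_gradient_line[OF H(1) w H(2), of f 0 v] has_gradient_line[OF H(1) w H(2), of f 0 v'] v
    by (auto intro: DERIV_unique)
  then have "(v - v') \<bullet> (v - v') = 0" by (simp add: inner_diff_right)
  then show ?thesis by simp
qed

lemma has_gradient_gradient:
  assumes "subspace H" "y \<in> H" "has_gradient H f y v"
  shows "has_gradient H f y (gradient H f y)"
  unfolding gradient_def
  by (rule theI[where a = v], rule assms(3), rule has_gradient_unique[OF assms(1,2) _ assms(3)])

text \<open>Difference quotients from the right are bounded by the chord slope. Convexity is
  available on the unit interval only, hence the one-sided limit.\<close>

lemma convex_derivative_le:
  fixes \<phi> :: "real \<Rightarrow> real"
  assumes cv: "\<And>t. 0 < t \<Longrightarrow> t < 1 \<Longrightarrow> \<phi> t \<le> (1 - t) * \<phi> 0 + t * \<phi> 1"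
    and D: "(\<phi> has_real_derivative D) (at 0)"
  shows "\<phi> 0 + D \<le> \<phi> 1"
proof -
  have "((\<lambda>t. (\<phi> t - \<phi> 0) / t) \<longlongrightarrow> D) (at 0)"
    using D by (simp add: has_field_derivative_iff)
  then have "((\<lambda>t. (\<phi> t - \<phi> 0) / t) \<longlongrightarrow> D) (at_right 0)"
    by (rule filterlim_mono) (auto simp: at_le)
  moreover have "\<forall>\<^sub>F t in at_right 0. (\<phi> t - \<phi> 0) / t \<le> \<phi> 1 - \<phi> 0"
  proof -
    have "(\<phi> t - \<phi> 0) / t \<le> \<phi> 1 - \<phi> 0" if "0 < t" "t < 1" for t
      using cv[OF that] that by (simp add: field_simps)
    then show ?thesis unfolding eventually_at_right_field by (intro exI[of _ 1]) auto
  qed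
  ultimately have "D \<le> \<phi> 1 - \<phi> 0" by (rule tendsto_upperbound) simp
  then show ?thesis by simp
qed

text \<open>The descent lemma for a Lipschitz gradient, by monotonicity along a segment rather than
  by integration.\<close>

lemma descent_inequality:
  assumes H: "subspace H" "K \<subseteq> H" and K: "convex K" "a \<in> K" "b \<in> K"
    and grad: "\<And>y. y \<in> K \<Longrightarrow> has_gradient H f y (G y)" and lip: "c-lipschitz_on K G"
  shows "f a \<le> f b + G b \<bullet> (a - b) + c * (norm (a - b))\<^sup>2 / 2"
proof -
  define w where "w = (\<lambda>t. b + t *\<^sub>R (a - b))"
  have wK: "w t \<in> K" if "0 \<le> t" "t \<le> 1" for t
  proof -
    have "w t = (1 - t) *\<^sub>R b + t *\<^sub>R a" by (simp add: w_def algebra_simps)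
    then show ?thesis using K that by (simp add: convex_alt)
  qed
  \<comment> \<open>Subtracting the claimed linear and quadratic growth makes the derivative
    nonpositive, by Cauchy--Schwarz and the Lipschitz bound; comparing the endpoints is the
    claim.\<close>
  define \<psi> where "\<psi> = (\<lambda>t. f (w t) - t * (G b \<bullet> (a - b)) - c * t\<^sup>2 / 2 * (norm (a - b))\<^sup>2)"
  have "\<psi> 1 \<le> \<psi> 0"
  proof (rule DERIV_nonpos_imp_nonincreasing[where f = \<psi>])
    fix t :: real assume t: "0 \<le> t" "t \<le> 1"
    have "((\<lambda>t. f (w t)) has_real_derivative (a - b) \<bullet> G (w t)) (at t)"
      using grad[OF wK[OF t]] H K unfolding w_def by (intro has_gradient_line[of H]) auto
    then have "(\<psi> has_real_derivative (a - b) \<bullet> G (w t) - G b \<bullet> (a - b) - c * t * (norm (a - b))\<^sup>2) (at t)"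
      unfolding \<psi>_def by (auto intro!: derivative_eq_intros)
    moreover have "(a - b) \<bullet> G (w t) - G b \<bullet> (a - b) - c * t * (norm (a - b))\<^sup>2 \<le> 0"
    proof -
      have "(a - b) \<bullet> G (w t) - G b \<bullet> (a - b) = (G (w t) - G b) \<bullet> (a - b)"
        by (simp add: inner_diff_left inner_diff_right inner_commute)
      also have "\<dots> \<le> norm (G (w t) - G b) * norm (a - b)" by (rule norm_cauchy_schwarz)
      also have "norm (G (w t) - G b) \<le> c * norm (w t - b)"
        using lipschitz_onD[OF lip wK[OF t] K(3)] by (simp add: dist_norm)
      also have "norm (w t - b) = t * norm (a - b)" using t by (simp add: w_def)
      finally show ?thesis by (simp add: mult_right_mono power2_eq_square algebra_simps)
    qed
    ultimately show "\<exists>y. (\<psi> has_real_derivative y) (at t) \<and> y \<le> 0" by blast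
  qed simp
  then show ?thesis by (simp add: \<psi>_def w_def)
qed

section \<open>The rescaled problem\<close>

definition rescale :: "('m \<Rightarrow> real) \<Rightarrow> 'e::real_vector ^ 'm::finite \<Rightarrow> 'e ^ 'm" where
  "rescale Lt y = (\<chi> j. sqrt (Lt j) *\<^sub>R y $ j)"

lemma linear_rescale: "linear (rescale Lt)"
  by (intro linearI) (simp_all add: rescale_def vec_eq_iff scaleR_right_distrib)

lemma avg_linear: "linear h \<Longrightarrow> avg (\<lambda>i. h (s i)) = h (avg s)"
  by (simp add: avg_def linear_sum linear_scale)

lemma mean_linear: "linear h \<Longrightarrow> mean \<mu> (\<lambda>x. h (F x)) = h (mean \<mu> F)"
  by (simp add: mean_def linear_sum linear_scale)

lemma gvec_resc_g: "gvec (resc_g Lt g) i x = rescale Lt (gvec g i x)"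
  by (simp add: gvec_def resc_g_def rescale_def)

lemma fsum_resc_f_rescale:
  assumes "\<And>j. 0 < Lt j"
  shows "fsum (resc_f Lt f) (rescale Lt y) = fsum f y"
proof -
  have "sqrt (Lt j) \<noteq> 0" for j using assms[of j] by simp
  then show ?thesis by (simp add: fsum_def resc_f_def rescale_def)
qed

lemma linear_inv_scaled_component: "linear (\<lambda>y :: 'e::real_vector ^ 'm. y $ j /\<^sub>R c)"
  by (intro linearI) (simp_all add: scaleR_right_distrib)

lemma power2_norm_vec: "(norm (y :: 'e::real_normed_vector ^ 'm::finite))\<^sup>2 = (\<Sum>j\<in>UNIV. (norm (y $ j))\<^sup>2)"
  by (simp add: norm_vec_def L2_set_def sum_nonneg)

lemma subspace_prod_space: "(\<And>j. subspace (E j)) \<Longrightarrow> subspace (prod_space E)"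
  by (auto simp: subspace_def prod_space_def)

text \<open>Undoing the scaling in one block is linear, so it commutes with averages and convex
  hulls. This carries points of \<open>conv(\<Y>)\<close> to the sets on which the assumptions on
  \<open>f j\<close> hold.\<close>

lemma component_in_hull_S_set:
  fixes g :: "'n::finite \<Rightarrow> 'm::finite \<Rightarrow> 'x \<Rightarrow> 'e::real_vector"
  assumes Lt: "0 < Lt j" and y: "y \<in> convex hull set_avg (Y_set X g Lt)"
  shows "y $ j /\<^sub>R sqrt (Lt j) \<in> convex hull S_set X g j"
proof -
  let ?T = "\<lambda>y :: 'e ^ 'm. y $ j /\<^sub>R sqrt (Lt j)"
  have lin: "linear ?T" by (rule linear_inv_scaled_component)
  have "?T ` set_avg (Y_set X g Lt) \<subseteq> S_set X g j"
  proof clarify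
    fix y assume "y \<in> set_avg (Y_set X g Lt)"
    then obtain s where s: "\<And>i. s i \<in> Y_set X g Lt i" "y = avg s" by (auto simp: set_avg_eq)
    have "?T (s i) \<in> g i j ` X i" for i
      using s(1)[of i] Lt by (auto simp: Y_set_def gvec_def resc_g_def)
    then show "?T y \<in> S_set X g j"
      unfolding s(2) avg_linear[OF lin, symmetric] S_set_def set_avg_eq by auto
  qed
  then have "convex hull (?T ` set_avg (Y_set X g Lt)) \<subseteq> convex hull S_set X g j" by (rule hull_mono)
  then show ?thesis
    using imageI[OF y, of ?T] unfolding convex_hull_linear_image[OF lin] by (rule subsetD)
qed

text \<open>Supplies \<open>grad\<close> for \<open>decomposition_bound\<close>. The minorant comes
  from convexity on the whole product space; the upper bound is the descent inequality in each
  block, whose constants the scaling normalizes to 1.\<close>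

lemma rescaled_gradient:
  fixes E :: "'m::finite \<Rightarrow> 'e::{real_inner,complete_space} set"
  assumes E: "\<And>j. subspace (E j)" and g: "\<And>i j x. x \<in> X i \<Longrightarrow> g i j x \<in> E j"
    and A1: "assumption1 X E g f L Lt" and cv: "convex_on (prod_space E) (fsum f)"
    and y: "y \<in> convex hull set_avg (Y_set X g Lt)"
  defines "F \<equiv> fsum (resc_f Lt f)"
  obtains v where "v \<in> prod_space E" "\<And>z. z \<in> prod_space E \<Longrightarrow> F y + v \<bullet> (z - y) \<le> F z"
    "\<And>z. z \<in> convex hull set_avg (Y_set X g Lt) \<Longrightarrow> F z \<le> F y + v \<bullet> (z - y) + (norm (z - y))\<^sup>2 / 2"
proof -
  define K where "K = (\<lambda>j. convex hull S_set X g j)"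
  define T where "T = (\<lambda>y :: 'e ^ 'm. \<chi> j. y $ j /\<^sub>R sqrt (Lt j))"
  define G where "G = (\<lambda>j. gradient (E j) (f j))"
  \<comment> \<open>The gradient of the rescaled cost by the chain rule; \<open>T\<close> undoes the
    scaling.\<close>
  define v where "v = (\<chi> j. G j (T y $ j) /\<^sub>R sqrt (Lt j))"
  have Lt: "0 < Lt j" for j using A1 by (simp add: assumption1_def)
  have KE: "K j \<subseteq> E j" for j
  proof -
    have "S_set X g j \<subseteq> E j"
      unfolding S_set_def set_avg_eq
    proof (rule image_subsetI)
      fix s assume s: "s \<in> (\<Pi> i\<in>UNIV. g i j ` X i)"
      have "s i \<in> E j" for i
      proof -
        have "s i \<in> g i j ` X i" using s by (simp add: Pi_iff)
        then show ?thesis using g by auto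
      qed
      then show "avg s \<in> E j"
        unfolding avg_def by (intro subspace_scale[OF E] subspace_sum[OF E])
    qed
    then show ?thesis unfolding K_def using E by (intro hull_minimal subspace_imp_convex) auto
  qed
  have TK: "T z $ j \<in> K j" if "z \<in> convex hull set_avg (Y_set X g Lt)" for z j
    using component_in_hull_S_set[OF Lt that] by (simp add: T_def K_def)
  have F_eq: "F z = (\<Sum>j\<in>UNIV. f j (T z $ j))" for z by (simp add: F_def fsum_def resc_f_def T_def)
  have G: "has_gradient (E j) (f j) u (G j u)" if "u \<in> K j" for u j
  proof -
    obtain U where U: "K j \<subseteq> U" "\<forall>y\<in>U. \<exists>v. has_gradient (E j) (f j) y v"
      using A1 unfolding assumption1_def continuously_differentiable_near_def K_def by meson
    from bspec[OF U(2) subsetD[OF U(1) that]] obtain v where "has_gradient (E j) (f j) u v" ..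
    then show ?thesis unfolding G_def by (rule has_gradient_gradient[OF E subsetD[OF KE that]])
  qed
  have Tdiff: "T z $ j - T y $ j = (z - y) $ j /\<^sub>R sqrt (Lt j)" for z j
    by (simp add: T_def scaleR_right_diff_distrib)
  have v_inner: "v \<bullet> (z - y) = (\<Sum>j\<in>UNIV. G j (T y $ j) \<bullet> (T z $ j - T y $ j))" for z
    unfolding Tdiff by (simp add: inner_vec_def v_def)
  have TyE: "T y $ j \<in> E j" for j by (rule subsetD[OF KE TK[OF y]])
  show ?thesis
  proof
    show "v \<in> prod_space E"
      using G[OF TK[OF y]] E by (auto simp: prod_space_def v_def has_gradient_def intro!: subspace_scale)
    show "F y + v \<bullet> (z - y) \<le> F z" if z: "z \<in> prod_space E" for z
    proof -
      have TzE: "T z $ j \<in> E j" for j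
        using z E by (auto simp: T_def prod_space_def intro!: subspace_scale)
      \<comment> \<open>The cost on the segment from \<open>T y\<close> to \<open>T z\<close>. The
        point \<open>T z\<close> may lie outside the hulls \<open>K j\<close>, so the derivative is
        taken at parameter 0 only.\<close>
      define \<phi> where "\<phi> = (\<lambda>t. \<Sum>j\<in>UNIV. f j (T y $ j + t *\<^sub>R (T z $ j - T y $ j)))"
      have "\<phi> 0 + v \<bullet> (z - y) \<le> \<phi> 1"
      proof (rule convex_derivative_le)
        show "(\<phi> has_real_derivative v \<bullet> (z - y)) (at 0)"
          unfolding \<phi>_def v_inner
        proof (rule DERIV_sum)
          show "((\<lambda>t. f j (T y $ j + t *\<^sub>R (T z $ j - T y $ j))) has_real_derivative
             G j (T y $ j) \<bullet> (T z $ j - T y $ j)) (at 0)" for j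
            using has_gradient_line[OF E TzE[of j] TyE[of j], of "f j" 0 "G j (T y $ j)"] G[OF TK[OF y]]
            by (simp add: inner_commute)
        qed
        fix t :: real assume t: "0 < t" "t < 1"
        have eq: "\<phi> t = fsum f ((1 - t) *\<^sub>R T y + t *\<^sub>R T z)" for t
          by (simp add: \<phi>_def fsum_def algebra_simps)
        have "T y \<in> prod_space E" "T z \<in> prod_space E" using TyE TzE by (auto simp: prod_space_def)
        then show "\<phi> t \<le> (1 - t) * \<phi> 0 + t * \<phi> 1"
          using convex_onD[OF cv, of t "T y" "T z"] t by (simp add: eq)
      qed
      then show ?thesis by (simp add: \<phi>_def F_eq)
    qed
    show "F z \<le> F y + v \<bullet> (z - y) + (norm (z - y))\<^sup>2 / 2"
      if z: "z \<in> convex hull set_avg (Y_set X g Lt)" for z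
    proof -
      have "f j (T z $ j) \<le> f j (T y $ j) + G j (T y $ j) \<bullet> (T z $ j - T y $ j) + (norm ((z - y) $ j))\<^sup>2 / 2" for j
      proof -
        have "f j (T z $ j) \<le> f j (T y $ j) + G j (T y $ j) \<bullet> (T z $ j - T y $ j) + Lt j * (norm (T z $ j - T y $ j))\<^sup>2 / 2"
          using A1 TK[OF y, of j] TK[OF z, of j] G KE[of j] E
          by (intro descent_inequality[of "E j" "K j"])
             (auto simp: assumption1_def K_def G_def convex_convex_hull)
        \<comment> \<open>The purpose of the rescaling: the factor \<open>1 / sqrt (Lt j)\<close>,
          squared, cancels the Lipschitz constant.\<close>
        moreover have "Lt j * (norm (T z $ j - T y $ j))\<^sup>2 = (norm ((z - y) $ j))\<^sup>2"
          unfolding Tdiff using Lt[of j] by (simp add: power_mult_distrib power_inverse)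
        ultimately show ?thesis by simp
      qed
      then have "F z \<le> (\<Sum>j\<in>UNIV. f j (T y $ j) + G j (T y $ j) \<bullet> (T z $ j - T y $ j) + (norm ((z - y) $ j))\<^sup>2 / 2)"
        unfolding F_eq by (rule sum_mono)
      also have "\<dots> = F y + v \<bullet> (z - y) + (norm (z - y))\<^sup>2 / 2"
        unfolding F_eq v_inner power2_norm_vec by (simp add: sum.distrib sum_divide_distrib)
      finally show ?thesis .
    qed
  qed
qed

section \<open>Transfer of bounds and values between the original and the rescaled problem\<close>

lemma bounded_Y_set:
  assumes "assumption1 X E g f L Lt"
  shows "bounded (Y_set X g Lt i)"
proof -
  have "\<forall>j. \<exists>b. \<forall>x\<in>X i. norm (g i j x) \<le> b"
    using assms by (auto simp: assumption1_def bounded_iff)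
  then obtain b where b: "\<And>j x. x \<in> X i \<Longrightarrow> norm (g i j x) \<le> b j" by metis
  have "norm (gvec (resc_g Lt g) i x) \<le> (\<Sum>j\<in>UNIV. \<bar>sqrt (Lt j)\<bar> * b j)" if "x \<in> X i" for x
  proof -
    have "norm (gvec (resc_g Lt g) i x) \<le> (\<Sum>j\<in>UNIV. norm (gvec (resc_g Lt g) i x $ j))"
      unfolding norm_vec_def by (rule L2_set_le_sum) auto
    also have "\<dots> \<le> (\<Sum>j\<in>UNIV. \<bar>sqrt (Lt j)\<bar> * b j)"
      using b that by (intro sum_mono) (auto simp: gvec_def resc_g_def intro!: mult_left_mono)
    finally show ?thesis .
  qed
  then show ?thesis unfolding bounded_iff Y_set_def by auto
qed

text \<open>Minimizers in the image set lift to minimizing decisions, and rescaling leaves the cost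
  unchanged.\<close>

lemma J_dec_le:
  assumes Lt: "\<And>j. 0 < Lt j"
  shows "J_dec X g f Lt lam \<le>
    (INF z\<in>(\<Pi> i\<in>UNIV. Y_argmin X g Lt i lam). ereal (fsum (resc_f Lt f) (avg z)))"
proof (rule INF_greatest)
  fix z assume z: "z \<in> (\<Pi> i\<in>UNIV. Y_argmin X g Lt i lam)"
  have "\<exists>x. x \<in> X i \<and> x \<in> X_argmin X g Lt i lam \<and> z i = gvec (resc_g Lt g) i x" for i
  proof -
    have "z i \<in> Y_argmin X g Lt i lam" using z by auto
    then show ?thesis by (auto simp: Y_argmin_def X_argmin_def Y_set_def argmin_set_def is_arg_min_def)
  qed
  then obtain x where x: "\<And>i. x i \<in> X i" "\<And>i. x i \<in> X_argmin X g Lt i lam"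
    "\<And>i. z i = rescale Lt (gvec g i (x i))" unfolding gvec_resc_g by metis
  have "z = (\<lambda>i. rescale Lt (gvec g i (x i)))" using x(3) by auto
  then have "fsum (resc_f Lt f) (avg z) = cost f g x"
    by (simp add: avg_linear[OF linear_rescale] fsum_resc_f_rescale[OF Lt] cost_def Gmap_def)
  then show "J_dec X g f Lt lam \<le> ereal (fsum (resc_f Lt f) (avg z))"
    unfolding J_dec_def using x(1,2) by (intro INF_lower2[of x]) auto
qed

text \<open>Means and averages commute with the linear rescaling, so each randomized decision has
  the cost of a point of \<open>conv(\<Y>)\<close>.\<close>

lemma rand_opt_val_ge:
  assumes Lt: "\<And>j. 0 < Lt j"
    and c: "\<And>z. z \<in> convex hull set_avg (Y_set X g Lt) \<Longrightarrow> c \<le> fsum (resc_f Lt f) z"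
  shows "ereal c \<le> rand_opt_val X f g"
  unfolding rand_opt_val_def
proof (rule INF_greatest)
  fix \<mu> assume \<mu>: "\<mu> \<in> (\<Pi> i\<in>UNIV. fin_prob (X i))"
  let ?z = "avg (\<lambda>i. mean (\<mu> i) (gvec (resc_g Lt g) i))"
  have "?z \<in> convex hull set_avg (Y_set X g Lt)"
    unfolding convex_hull_set_avg unfolding set_avg_eq Y_set_def
    using \<mu> by (intro imageI Pi_I mean_in_convex_hull) auto
  moreover have "gvec (resc_g Lt g) i = (\<lambda>x. rescale Lt (gvec g i x))" for i
    by (simp add: gvec_resc_g fun_eq_iff)
  then have "fsum (resc_f Lt f) ?z = rand_cost f g \<mu>"
    by (simp add: mean_linear[OF linear_rescale] avg_linear[OF linear_rescale]
        fsum_resc_f_rescale[OF Lt] rand_cost_def)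
  ultimately show "ereal c \<le> ereal (rand_cost f g \<mu>)" using c[of ?z] by simp
qed

text \<open>A deterministic decision is a family of Dirac distributions.\<close>

lemma rand_opt_val_le_opt_val: "rand_opt_val X f g \<le> opt_val X f g"
  unfolding opt_val_def
proof (rule INF_greatest)
  fix x assume "x \<in> Pi UNIV X"
  then show "rand_opt_val X f g \<le> ereal (cost f g x)"
    unfolding rand_opt_val_def
    by (intro INF_lower2[of "\<lambda>i. return_pmf (x i)"])
       (auto intro!: return_pmf_in_fin_prob simp: rand_cost_def cost_def Gmap_def)
qed

lemma dual_obj_eq_lagrange_dual:
  "dual_obj X E g f Lt = lagrange_dual (Y_set X g Lt) (prod_space E) (fsum (resc_f Lt f))"
  by (simp add: fun_eq_iff dual_obj_def lagrange_dual_def Phi_def Y_set_def image_image)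

theorem proposition4p9:
  fixes X :: "'n::finite \<Rightarrow> 'x set"
    and E :: "'m::finite \<Rightarrow> 'e::{real_inner,complete_space} set"
    and g :: "'n \<Rightarrow> 'm \<Rightarrow> 'x \<Rightarrow> 'e"
    and f :: "'m \<Rightarrow> 'e \<Rightarrow> real"
    and L Lt :: "'m \<Rightarrow> real"
    and lam :: "'e ^ 'm"
    and q :: enat
    and p :: ereal
  assumes "\<And>i. X i \<noteq> {}"
    and "\<And>j. separable_hilbert_subspace (E j)"
    and "\<And>i j x. x \<in> X i \<Longrightarrow> g i j x \<in> E j"
    and "assumption1 X E g f L Lt"
    and "assumption2 X g f"
    and "assumption3 X E g f"
    and "assumption4 X E g f Lt"
    and "dual_solution X E g f Lt lam"
    and "q = edim (prod_space E)"
    and "p = J_dec X g f Lt lam - opt_val X f g"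
  shows "p \<le> J_dec X g f Lt lam - rand_opt_val X f g \<and>
         J_dec X g f Lt lam - rand_opt_val X f g
           \<le> ereal (1 / (2 * (real CARD('n))\<^sup>2)) *
              (MAX Q\<in>{Q :: 'n set. enat (card Q) = min q (enat CARD('n))}.
                 \<Sum>i\<in>Q. (rho (Y_argmin X g Lt i lam))\<^sup>2)"
proof
  show "p \<le> J_dec X g f Lt lam - rand_opt_val X f g"
    unfolding assms(10) using rand_opt_val_le_opt_val by (intro ereal_minus_mono) auto
  have E: "subspace (E j)" for j using assms(2) by (simp add: separable_hilbert_subspace_def)
  have Lt: "0 < Lt j" for j using assms(4) by (simp add: assumption1_def)
  define M where "M = (MAX Q\<in>{Q :: 'n set. enat (card Q) = min q (enat CARD('n))}.
                 \<Sum>i\<in>Q. (rho (Y_argmin X g Lt i lam))\<^sup>2)"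
  let ?F = "fsum (resc_f Lt f)" and ?c = "ereal (1 / (2 * (real CARD('n))\<^sup>2))"
  obtain y where y: "\<And>z. z \<in> convex hull set_avg (Y_set X g Lt) \<Longrightarrow> ?F y \<le> ?F z"
    and le: "(INF z\<in>(\<Pi> i\<in>UNIV. Y_argmin X g Lt i lam). ereal (?F (avg z))) \<le> ereal (?F y) + ?c * M"
  proof (rule decomposition_bound[of "Y_set X g Lt" "prod_space E" ?F lam])
    show "Y_set X g Lt i \<noteq> {}" for i using assms(1) by (simp add: Y_set_def)
    show "bounded (Y_set X g Lt i)" for i using assms(4) by (rule bounded_Y_set)
    show "subspace (prod_space E)" using E by (rule subspace_prod_space)
    show "Y_set X g Lt i \<subseteq> prod_space E" for i
      using assms(3) E by (auto simp: Y_set_def gvec_def resc_g_def prod_space_def intro!: subspace_scale)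
    show "closed (convex hull set_avg (Y_set X g Lt))" using assms(7) by (simp add: assumption4_def)
    fix y assume "y \<in> convex hull set_avg (Y_set X g Lt)"
    moreover have "convex_on (prod_space E) (fsum f)" using assms(7) by (simp add: assumption4_def)
    ultimately obtain v where "v \<in> prod_space E"
      "\<And>z. z \<in> prod_space E \<Longrightarrow> ?F y + v \<bullet> (z - y) \<le> ?F z"
      "\<And>z. z \<in> convex hull set_avg (Y_set X g Lt) \<Longrightarrow> ?F z \<le> ?F y + v \<bullet> (z - y) + (norm (z - y))\<^sup>2 / 2"
      using rescaled_gradient[OF E assms(3,4)] by blast
    then show "\<exists>v\<in>prod_space E. (\<forall>z\<in>prod_space E. ?F y + v \<bullet> (z - y) \<le> ?F z) \<and>
      (\<forall>z\<in>convex hull set_avg (Y_set X g Lt). ?F z \<le> ?F y + v \<bullet> (z - y) + (norm (z - y))\<^sup>2 / 2)"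
      by blast
  next
    fix l' assume "l' \<in> prod_space E"
    then show "lagrange_dual (Y_set X g Lt) (prod_space E) ?F l' \<le> lagrange_dual (Y_set X g Lt) (prod_space E) ?F lam"
      using assms(8) unfolding dual_solution_def dual_obj_eq_lagrange_dual by (metis SUP_upper)
  qed (auto simp: M_def Y_argmin_def assms(9))
  have "J_dec X g f Lt lam - rand_opt_val X f g \<le> (ereal (?F y) + ?c * M) - ereal (?F y)"
    using order_trans[OF J_dec_le[OF Lt] le] rand_opt_val_ge[OF Lt y] by (rule ereal_minus_mono)
  \<comment> \<open>The value \<open>?F y\<close> is a real number and cancels; the cases cover a
    possibly infinite \<open>?c * M\<close>.\<close>
  also have "\<dots> \<le> ?c * M" by (cases "?c * M") auto
  finally show "J_dec X g f Lt lam - rand_opt_val X f g \<le> ?c *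
      (MAX Q\<in>{Q :: 'n set. enat (card Q) = min q (enat CARD('n))}.
         \<Sum>i\<in>Q. (rho (Y_argmin X g Lt i lam))\<^sup>2)" unfolding M_def .
qed

end
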